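(* Let $a,b,d,e,\mu$ be nonzero complex numbers with $\bigl|\frac{aq}{\mu b^2e}\bigr|<1$. For $x=\frac12\bigl(t+\mu^{-1}t^{-1}\bigr)$, $t\in\mathbb C\setminus\{0\}$ (i.e. $t=e^\xi$), put $$U_n(x)=\frac1{d^n}\,\frac{(aq,\frac{aq}{\mu b^2e})_n}{(\frac{aq}{d},\frac{aq}{\mu b^2de})_n}\;{}_4\phi_3\Bigl({\frac{aq}{\mu b^2},\,d,\,\frac{a^2q^{1+n}}{\mu b^2de},\,q^{-n}\atop\frac{aq}{b}t,\,\frac{aq}{b\mu}t^{-1},\,\frac{aq}{\mu b^2e}};q\Bigr),$$ $$V_m(x)=\Bigl(\frac eq\Bigr)^m\frac{(\frac{aq^2}{de},\frac{aq}{\mu b^2e})_m}{(\frac{aq}{d},\frac{a}{\mu b^2})_m}\;{}_4\phi_3\Bigl({\frac{aq^2}{\mu b^2de},\,\frac qe,\,\frac{a^2q^{m+1}}{\mu b^2de},\,q^{-m}\atop\frac{aq^2}{bde}t,\,\frac{aq^2}{\mu bde}t^{-1},\,\frac{aq}{\mu b^2e}};q\Bigr).$$ Then, for all integers $n,m\ge0$, $$\sum_{k=0}^\infty U_n(x_k)V_m(x_k)\,r_k=C_n\,\delta_{n,m},$$ where $x_k=\frac12\bigl(bq^k+\frac{q^{-k}}{b\mu}\bigr)$, $$r_k=\frac{\bigl(\mu b^2,\,q\sqrt{\mu b^2},\,-q\sqrt{\mu b^2},\,\frac{\mu b^2}{a},\,\frac{aq}{d},\,\frac{\mu b^2de}{aq}\bigr)_k}{\bigl(\sqrt{\mu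 b^2},\,-\sqrt{\mu b^2},\,aq,\,\frac{\mu b^2d}{a},\,\frac{aq^2}{de},\,q\bigr)_k}\Bigl(\frac{aq}{\mu b^2e}\Bigr)^k\,\frac{\bigl(aq,\frac{\mu b^2d}{a},\frac{aq}{\mu b^2e},\frac{aq^2}{de}\bigr)_\infty}{\bigl(\mu b^2q,\,d,\,\frac qe,\,\frac{a^2q^2}{\mu b^2de}\bigr)_\infty},$$ $$C_n=\frac{\bigl(q,\frac{aq}{\mu b^2e},\frac{aq^2}{de},aq\bigr)_n}{\bigl(\frac{aq}{\mu b^2de},\frac{aq}{d},\frac{a}{\mu b^2},\frac{a^2q^2}{\mu b^2de}\bigr)_n}\Bigl(\frac{a}{\mu b^2d}\Bigr)^n\,\frac{1-\frac{a^2q^{1+n}}{\mu b^2de}}{1-\frac{a^2q^{1+2n}}{\mu b^2de}} .$$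
   Context: Throughout $q\in\mathbb C$, $0<|q|<1$; $(x)_0=1$, $(x)_k=\prod_{j=0}^{k-1}(1-xq^j)$, $(x)_\infty=\prod_{j\ge0}(1-xq^j)$, $(x_1,\dots,x_r)_k=\prod_i (x_i)_k$. The parameter $e$ is a complex number (not Euler's number). $${}_4\phi_3\Bigl({\alpha_1,\alpha_2,\alpha_3,q^{-n}\atop\beta_1,\beta_2,\beta_3};q\Bigr)=\sum_{k=0}^n\frac{(\alpha_1,\alpha_2,\alpha_3,q^{-n})_k}{(\beta_1,\beta_2,\beta_3,q)_k}\,q^k .$$ $U_n,V_m$ are invariant under $t\mapsto1/(\mu t)$, hence functions of $x$; at $x=x_k$ one takes $t=bq^k$. Standing assumption: parameters are such that no zero denominators occur. *)

theory Defs
  imports "HOL-Analysis.Analysis"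
begin

definition qpoch :: "complex \<Rightarrow> complex \<Rightarrow> nat \<Rightarrow> complex" where
  "qpoch q x k = (\<Prod>j<k. 1 - x * q ^ j)"

definition qpoch_inf :: "complex \<Rightarrow> complex \<Rightarrow> complex" where
  "qpoch_inf q x = (\<Prod>j. 1 - x * q ^ j)"

definition qpochs :: "complex \<Rightarrow> complex list \<Rightarrow> nat \<Rightarrow> complex" where
  "qpochs q xs k = (\<Prod>x\<leftarrow>xs. qpoch q x k)"

definition qpochs_inf :: "complex \<Rightarrow> complex list \<Rightarrow> complex" where
  "qpochs_inf q xs = (\<Prod>x\<leftarrow>xs. qpoch_inf q x)"

text \<open>The terminating series with upper parameters \<open>\<alpha>1, \<alpha>2, \<alpha>3, q\<^sup>-\<^sup>n\<close>
  and lower parameters \<open>\<beta>1, \<beta>2, \<beta>3\<close>.\<close>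

definition phi43 ::
  "complex \<Rightarrow> complex \<Rightarrow> complex \<Rightarrow> complex \<Rightarrow> nat \<Rightarrow> complex \<Rightarrow> complex \<Rightarrow> complex \<Rightarrow> complex" where
  "phi43 q \<alpha>1 \<alpha>2 \<alpha>3 n \<beta>1 \<beta>2 \<beta>3 =
     (\<Sum>k\<le>n. qpochs q [\<alpha>1, \<alpha>2, \<alpha>3, q powi (- int n)] k / qpochs q [\<beta>1, \<beta>2, \<beta>3, q] k * q ^ k)"

definition x_of :: "complex \<Rightarrow> complex \<Rightarrow> complex" where
  "x_of \<mu> t = (t + inverse \<mu> * inverse t) / 2"

definition t_of :: "complex \<Rightarrow> complex \<Rightarrow> complex" where
  "t_of \<mu> x = (SOME t. t \<noteq> 0 \<and> x = x_of \<mu> t)"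

definition U_par ::
  "complex \<Rightarrow> complex \<Rightarrow> complex \<Rightarrow> complex \<Rightarrow> complex \<Rightarrow> complex \<Rightarrow> nat \<Rightarrow> complex \<Rightarrow> complex" where
  "U_par q a b d e \<mu> n t =
     1 / d ^ n
     * (qpochs q [a*q, a*q / (\<mu>*b^2*e)] n / qpochs q [a*q/d, a*q / (\<mu>*b^2*d*e)] n)
     * phi43 q (a*q / (\<mu>*b^2)) d (a^2 * q^(1+n) / (\<mu>*b^2*d*e)) n
         (a*q/b * t) (a*q / (b*\<mu>) * inverse t) (a*q / (\<mu>*b^2*e))"

definition V_par ::
  "complex \<Rightarrow> complex \<Rightarrow> complex \<Rightarrow> complex \<Rightarrow> complex \<Rightarrow> complex \<Rightarrow> nat \<Rightarrow> complex \<Rightarrow> complex" where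
  "V_par q a b d e \<mu> m t =
     (e / q) ^ m
     * (qpochs q [a*q^2 / (d*e), a*q / (\<mu>*b^2*e)] m / qpochs q [a*q/d, a / (\<mu>*b^2)] m)
     * phi43 q (a*q^2 / (\<mu>*b^2*d*e)) (q/e) (a^2 * q^(m+1) / (\<mu>*b^2*d*e)) m
         (a*q^2 / (b*d*e) * t) (a*q^2 / (\<mu>*b*d*e) * inverse t) (a*q / (\<mu>*b^2*e))"

text \<open>As functions of \<open>x\<close>; the value does not depend on the chosen \<open>t\<close>,
  see \<open>U_x_of\<close> and \<open>V_x_of\<close> below.\<close>

definition U ::
  "complex \<Rightarrow> complex \<Rightarrow> complex \<Rightarrow> complex \<Rightarrow> complex \<Rightarrow> complex \<Rightarrow> nat \<Rightarrow> complex \<Rightarrow> complex" where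
  "U q a b d e \<mu> n x = U_par q a b d e \<mu> n (t_of \<mu> x)"

definition V ::
  "complex \<Rightarrow> complex \<Rightarrow> complex \<Rightarrow> complex \<Rightarrow> complex \<Rightarrow> complex \<Rightarrow> nat \<Rightarrow> complex \<Rightarrow> complex" where
  "V q a b d e \<mu> m x = V_par q a b d e \<mu> m (t_of \<mu> x)"

definition x_node :: "complex \<Rightarrow> complex \<Rightarrow> complex \<Rightarrow> nat \<Rightarrow> complex" where
  "x_node q b \<mu> k = (b * q^k + q powi (- int k) / (b*\<mu>)) / 2"

text \<open>The root enters only through the symmetric pairs \<open>\<plusminus> csqrt (\<mu>*b^2)\<close>,
  so the choice of branch is immaterial.\<close>

definition weight ::
  "complex \<Rightarrow> complex \<Rightarrow> complex \<Rightarrow> complex \<Rightarrow> complex \<Rightarrow> complex \<Rightarrow> nat \<Rightarrow> complex" where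
  "weight q a b d e \<mu> k =
     qpochs q [\<mu>*b^2, q * csqrt (\<mu>*b^2), - q * csqrt (\<mu>*b^2),
               \<mu>*b^2 / a, a*q/d, \<mu>*b^2*d*e / (a*q)] k
     / qpochs q [csqrt (\<mu>*b^2), - csqrt (\<mu>*b^2), a*q, \<mu>*b^2*d / a, a*q^2 / (d*e), q] k
     * (a*q / (\<mu>*b^2*e)) ^ k
     * (qpochs_inf q [a*q, \<mu>*b^2*d / a, a*q / (\<mu>*b^2*e), a*q^2 / (d*e)]
        / qpochs_inf q [\<mu>*b^2*q, d, q/e, a^2*q^2 / (\<mu>*b^2*d*e)])"

definition norm_const ::
  "complex \<Rightarrow> complex \<Rightarrow> complex \<Rightarrow> complex \<Rightarrow> complex \<Rightarrow> complex \<Rightarrow> nat \<Rightarrow> complex" where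
  "norm_const q a b d e \<mu> n =
     qpochs q [q, a*q / (\<mu>*b^2*e), a*q^2 / (d*e), a*q] n
     / qpochs q [a*q / (\<mu>*b^2*d*e), a*q/d, a / (\<mu>*b^2), a^2*q^2 / (\<mu>*b^2*d*e)] n
     * (a / (\<mu>*b^2*d)) ^ n
     * ((1 - a^2*q^(1+n) / (\<mu>*b^2*d*e)) / (1 - a^2*q^(1+2*n) / (\<mu>*b^2*d*e)))"

text \<open>No zero denominators occur in \<open>U\<^sub>n(x\<^sub>k)\<close>, \<open>V\<^sub>m(x\<^sub>k)\<close>, \<open>r\<^sub>k\<close> (for any \<open>k\<close>) and \<open>C\<^sub>n\<close>.
  In a terminating series of order \<open>n\<close>, all denominators \<open>(\<beta>)\<^sub>k\<close> with \<open>k \<le> n\<close> are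
  nonzero iff \<open>(\<beta>)\<^sub>n\<close> is.\<close>

definition U_denoms_nonzero ::
  "complex \<Rightarrow> complex \<Rightarrow> complex \<Rightarrow> complex \<Rightarrow> complex \<Rightarrow> complex \<Rightarrow> nat \<Rightarrow> complex \<Rightarrow> bool" where
  "U_denoms_nonzero q a b d e \<mu> n t \<longleftrightarrow>
     qpochs q [a*q/d, a*q / (\<mu>*b^2*d*e)] n \<noteq> 0 \<and>
     qpochs q [a*q/b * t, a*q / (b*\<mu>) * inverse t, a*q / (\<mu>*b^2*e), q] n \<noteq> 0"

definition V_denoms_nonzero ::
  "complex \<Rightarrow> complex \<Rightarrow> complex \<Rightarrow> complex \<Rightarrow> complex \<Rightarrow> complex \<Rightarrow> nat \<Rightarrow> complex \<Rightarrow> bool" where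
  "V_denoms_nonzero q a b d e \<mu> m t \<longleftrightarrow>
     qpochs q [a*q/d, a / (\<mu>*b^2)] m \<noteq> 0 \<and>
     qpochs q [a*q^2 / (b*d*e) * t, a*q^2 / (\<mu>*b*d*e) * inverse t, a*q / (\<mu>*b^2*e), q] m \<noteq> 0"

definition weight_denoms_nonzero ::
  "complex \<Rightarrow> complex \<Rightarrow> complex \<Rightarrow> complex \<Rightarrow> complex \<Rightarrow> complex \<Rightarrow> nat \<Rightarrow> bool" where
  "weight_denoms_nonzero q a b d e \<mu> k \<longleftrightarrow>
     qpochs q [csqrt (\<mu>*b^2), - csqrt (\<mu>*b^2), a*q, \<mu>*b^2*d / a, a*q^2 / (d*e), q] k \<noteq> 0 \<and>
     qpochs_inf q [\<mu>*b^2*q, d, q/e, a^2*q^2 / (\<mu>*b^2*d*e)] \<noteq> 0"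

definition norm_const_denoms_nonzero ::
  "complex \<Rightarrow> complex \<Rightarrow> complex \<Rightarrow> complex \<Rightarrow> complex \<Rightarrow> complex \<Rightarrow> nat \<Rightarrow> bool" where
  "norm_const_denoms_nonzero q a b d e \<mu> n \<longleftrightarrow>
     qpochs q [a*q / (\<mu>*b^2*d*e), a*q/d, a / (\<mu>*b^2), a^2*q^2 / (\<mu>*b^2*d*e)] n \<noteq> 0 \<and>
     1 - a^2*q^(1+2*n) / (\<mu>*b^2*d*e) \<noteq> 0"

lemma x_of_eq_iff:
  assumes "\<mu> \<noteq> 0" "s \<noteq> 0" "t \<noteq> 0"
  shows "x_of \<mu> s = x_of \<mu> t \<longleftrightarrow> s = t \<or> s = inverse (\<mu> * t)"
proof -
  have "x_of \<mu> s - x_of \<mu> t = (s - t) * (\<mu> * s * t - 1) / (2 * \<mu> * s * t)"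
    using assms by (simp add: x_of_def field_simps)
  then have "x_of \<mu> s - x_of \<mu> t = 0 \<longleftrightarrow> (s - t) * (\<mu> * s * t - 1) = 0"
    using assms by simp
  also have "\<dots> \<longleftrightarrow> s = t \<or> s * (\<mu> * t) = 1"
    by (simp add: mult_ac)
  also have "\<dots> \<longleftrightarrow> s = t \<or> s = inverse (\<mu> * t)"
    using assms by (simp add: field_simps)
  finally show ?thesis by simp
qed

lemma t_of_x_of:
  assumes "\<mu> \<noteq> 0" "t \<noteq> 0"
  shows "t_of \<mu> (x_of \<mu> t) = t \<or> t_of \<mu> (x_of \<mu> t) = inverse (\<mu> * t)"
proof -
  have "t_of \<mu> (x_of \<mu> t) \<noteq> 0 \<and> x_of \<mu> t = x_of \<mu> (t_of \<mu> (x_of \<mu> t))"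
    unfolding t_of_def by (rule someI[of _ t]) (use assms in simp)
  then show ?thesis
    using x_of_eq_iff[OF assms(1) _ assms(2)] by metis
qed

lemma phi43_swap: "phi43 q A B C n x y z = phi43 q A B C n y x z"
  by (simp add: phi43_def qpochs_def mult_ac)

lemma U_par_invariant:
  assumes "\<mu> \<noteq> 0" "t \<noteq> 0"
  shows "U_par q a b d e \<mu> n (inverse (\<mu> * t)) = U_par q a b d e \<mu> n t"
proof -
  have "a*q/b * inverse (\<mu> * t) = a*q / (b*\<mu>) * inverse t"
    and "a*q / (b*\<mu>) * inverse (inverse (\<mu> * t)) = a*q/b * t"
    using assms by (simp_all add: field_simps)
  note eqs = this
  show ?thesis
    unfolding U_par_def eqs by (subst phi43_swap) (rule refl)
qed

lemma V_par_invariant: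
  assumes "\<mu> \<noteq> 0" "t \<noteq> 0"
  shows "V_par q a b d e \<mu> m (inverse (\<mu> * t)) = V_par q a b d e \<mu> m t"
proof -
  have "a*q^2 / (b*d*e) * inverse (\<mu> * t) = a*q^2 / (\<mu>*b*d*e) * inverse t"
    and "a*q^2 / (\<mu>*b*d*e) * inverse (inverse (\<mu> * t)) = a*q^2 / (b*d*e) * t"
    using assms by (simp_all add: field_simps)
  note eqs = this
  show ?thesis
    unfolding V_par_def eqs by (subst phi43_swap) (rule refl)
qed

lemma U_x_of:
  assumes "\<mu> \<noteq> 0" "t \<noteq> 0"
  shows "U q a b d e \<mu> n (x_of \<mu> t) = U_par q a b d e \<mu> n t"
  using t_of_x_of[OF assms] U_par_invariant[OF assms] by (auto simp: U_def)

lemma V_x_of: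
  assumes "\<mu> \<noteq> 0" "t \<noteq> 0"
  shows "V q a b d e \<mu> m (x_of \<mu> t) = V_par q a b d e \<mu> m t"
  using t_of_x_of[OF assms] V_par_invariant[OF assms] by (auto simp: V_def)

lemma x_node_eq_x_of: "x_node q b \<mu> k = x_of \<mu> (b * q ^ k)"
  unfolding x_node_def x_of_def power_int_minus power_int_of_nat divide_inverse inverse_mult_distrib
  by (simp only: mult_ac)

end

theory Submission
  imports Defs
begin

text \<open>Put \<open>A = \<mu> b\<^sup>2\<close>, \<open>X = a q / (A e)\<close> and \<open>Y = a\<^sup>2 q\<^sup>2 / (A d e)\<close>. The \<open>x\<^sub>k\<close>-dependent factors
  \<open>\<phi>\<^sub>j\<close> of the \<open>j\<close>-th term of \<open>U\<^sub>n\<close> and \<open>\<psi>\<^sub>i\<close> of the \<open>i\<close>-th term of \<open>V\<^sub>m\<close> merge with the very-well-poised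
  weight \<open>r\<^sub>k\<close>: they shift two of its parameters by \<open>q\<^sup>-\<^sup>j\<close> and \<open>q\<^sup>-\<^sup>i\<close>. The nonterminating
  \<open>\<^sub>6\<phi>\<^sub>5\<close> sum therefore evaluates the moments as
  \<open>\<Sum>\<^sub>k \<phi>\<^sub>j \<psi>\<^sub>i r\<^sub>k = (X)\<^sub>i\<^sub>+\<^sub>j / ((d)\<^sub>j (q/e)\<^sub>i (Y)\<^sub>i\<^sub>+\<^sub>j)\<close>. In the remaining double sum the sum over \<open>j\<close>
  is a balanced \<open>\<^sub>3\<phi>\<^sub>2\<close>, which by the \<open>q\<close>-Pfaff--Saalschuetz formula contains the factor
  \<open>(q\<^sup>i\<^sup>+\<^sup>1\<^sup>-\<^sup>n)\<^sub>n\<close> and vanishes for \<open>i < n\<close>;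
  symmetrically, the sum over \<open>i\<close> vanishes for \<open>j < m\<close>. For \<open>n = m\<close> the single value \<open>i = n\<close> survives.

  The \<open>\<^sub>6\<phi>\<^sub>5\<close> sum satisfies a first-order recurrence under \<open>A \<mapsto> A q\<close> with its other upper parameters
  fixed. This multiplies the argument by \<open>q\<close>, so the iterated series tends to \<open>1\<close> and the
  recurrence factors accumulate to the infinite products.\<close>

section \<open>Shifted factorials\<close>

lemma qpoch_0 [simp]: "qpoch q x 0 = 1"
  by (simp add: qpoch_def)

lemma qpoch_Suc: "qpoch q x (Suc k) = qpoch q x k * (1 - x * q ^ k)"
  by (simp add: qpoch_def)

lemma qpoch_add: "qpoch q x (m + n) = qpoch q x m * qpoch q (x * q ^ m) n"
  by (induction n) (simp_all add: qpoch_Suc power_add mult_ac)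

lemma qpoch_Suc_left: "qpoch q x (Suc k) = (1 - x) * qpoch q (x * q) k"
  using qpoch_add[of q x 1 k] by (simp add: qpoch_Suc)

lemma qpoch_shift: "(1 - x) * qpoch q (x * q) k = qpoch q x k * (1 - x * q ^ k)"
  using qpoch_Suc_left[of q x k] qpoch_Suc[of q x k] by simp

lemma qpoch_nonzero_iff: "qpoch q x n \<noteq> 0 \<longleftrightarrow> (\<forall>j<n. x * q ^ j \<noteq> 1)"
  by (auto simp: qpoch_def)

lemma qpoch_nonzero_mono: "qpoch q x n \<noteq> 0 \<Longrightarrow> m \<le> n \<Longrightarrow> qpoch q x m \<noteq> 0"
  by (simp add: qpoch_nonzero_iff)

lemma norm_less_one_power_ne_one:
  fixes q x :: complex
  assumes "norm q < 1" and "norm x < 1"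
  shows "x * q ^ j \<noteq> 1"
proof
  assume "x * q ^ j = 1"
  moreover have "norm (x * q ^ j) \<le> norm x * 1"
    unfolding norm_mult norm_power using assms by (intro mult_left_mono power_le_one) auto
  ultimately show False using assms by simp
qed

lemma qpoch_nonzero_of_norm_less_one:
  "norm q < 1 \<Longrightarrow> norm x < 1 \<Longrightarrow> qpoch q x n \<noteq> 0"
  by (simp add: qpoch_nonzero_iff norm_less_one_power_ne_one)

lemma convergent_prod_qpoch:
  assumes "norm q < 1"
  shows "convergent_prod (\<lambda>j. 1 - x * q ^ j :: complex)"
proof -
  have "summable (\<lambda>j. norm (x * q ^ j))"
    unfolding norm_mult norm_power using assms by (intro summable_mult summable_geometric) auto
  then show ?thesis
    by (intro abs_convergent_prod_imp_convergent_prod)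
       (simp add: abs_convergent_prod_conv_summable norm_minus_commute)
qed

lemma qpoch_tendsto_inf:
  assumes "norm q < 1"
  shows "qpoch q x \<longlonglongrightarrow> qpoch_inf q x"
proof -
  have "(\<lambda>n. \<Prod>i\<le>n. 1 - x * q ^ i) \<longlonglongrightarrow> qpoch_inf q x"
    unfolding qpoch_inf_def by (rule convergent_prod_LIMSEQ[OF convergent_prod_qpoch[OF assms]])
  then have "(\<lambda>n. qpoch q x (Suc n)) \<longlonglongrightarrow> qpoch_inf q x"
    by (simp add: qpoch_def lessThan_Suc_atMost)
  then show ?thesis by (simp add: LIMSEQ_imp_Suc)
qed

lemma qpoch_inf_nonzero:
  assumes "norm q < 1" and "\<And>j. x * q ^ j \<noteq> 1"
  shows "qpoch_inf q x \<noteq> 0"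
  unfolding qpoch_inf_def
  by (rule prodinf_nonzero[OF convergent_prod_qpoch[OF assms(1)]]) (use assms(2) in auto)

lemma qpoch_inf_split:
  assumes "norm q < 1"
  shows "qpoch_inf q x = qpoch q x n * qpoch_inf q (x * q ^ n)"
proof (rule LIMSEQ_unique)
  show "(\<lambda>k. qpoch q x (k + n)) \<longlonglongrightarrow> qpoch_inf q x"
    by (rule LIMSEQ_ignore_initial_segment[OF qpoch_tendsto_inf[OF assms]])
  have "(\<lambda>k. qpoch q x n * qpoch q (x * q ^ n) k) \<longlonglongrightarrow> qpoch q x n * qpoch_inf q (x * q ^ n)"
    by (intro tendsto_intros qpoch_tendsto_inf[OF assms])
  then show "(\<lambda>k. qpoch q x (k + n)) \<longlonglongrightarrow> qpoch q x n * qpoch_inf q (x * q ^ n)"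
    by (simp add: qpoch_add add.commute[of _ n])
qed

lemma qpoch_nonzero_of_inf_nonzero:
  assumes "norm q < 1" and "qpoch_inf q x \<noteq> 0"
  shows "qpoch q x n \<noteq> 0"
  using qpoch_inf_split[OF assms(1), of x n] assms(2) by auto

lemma qpoch_power_tendsto_1:
  assumes "norm q < 1"
  shows "(\<lambda>N. qpoch q (x * q ^ N) k) \<longlonglongrightarrow> 1"
proof -
  have "(\<lambda>N. \<Prod>j<k. 1 - x * q ^ N * q ^ j) \<longlonglongrightarrow> (\<Prod>j<k. 1 - x * 0 * q ^ j)"
    using assms by (intro tendsto_intros LIMSEQ_power_zero) auto
  then show ?thesis by (simp add: qpoch_def)
qed

lemma qpoch_bounded:
  assumes "norm q < 1"
  shows "\<exists>K>0. \<forall>k. norm (qpoch q x k) \<le> K"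
  using convergent_imp_Bseq[OF convergentI[OF qpoch_tendsto_inf[OF assms]]] by (auto simp: Bseq_def)

text \<open>Both bounds follow from \<open>(x q^N)_k = (x)_(N+k) / (x)_N\<close>, since
  \<open>(x)_k\<close> converges to a nonzero limit. Uniformity in \<open>N\<close> is what the
  limit in \<open>vwp_term_limit\<close> requires.\<close>

lemma qpoch_uniformly_bounded:
  assumes "norm q < 1" and "\<And>j. x * q ^ j \<noteq> 1"
  shows "\<exists>K>0. \<forall>N k. norm (qpoch q (x * q ^ N) k) \<le> K \<and> norm (inverse (qpoch q (x * q ^ N) k)) \<le> K"
proof -
  have nz: "qpoch q x n \<noteq> 0" for n
    using assms(2) by (simp add: qpoch_nonzero_iff)
  obtain K1 where K1: "K1 > 0" "\<And>k. norm (qpoch q x k) \<le> K1"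
    using qpoch_bounded[OF assms(1), of x] by blast
  have "(\<lambda>k. inverse (qpoch q x k)) \<longlonglongrightarrow> inverse (qpoch_inf q x)"
    by (intro tendsto_inverse qpoch_tendsto_inf assms qpoch_inf_nonzero)
  then have "Bseq (\<lambda>k. inverse (qpoch q x k))"
    by (intro convergent_imp_Bseq convergentI)
  then obtain K2 where K2: "K2 > 0" "\<And>k. norm (inverse (qpoch q x k)) \<le> K2"
    by (auto simp: Bseq_def)
  show ?thesis
  proof (intro exI[of _ "K1 * K2"] conjI allI)
    show "K1 * K2 > 0" using K1 K2 by simp
    fix N k
    have eq: "qpoch q (x * q ^ N) k = qpoch q x (N + k) * inverse (qpoch q x N)"
      using nz by (simp add: qpoch_add field_simps)
    show "norm (qpoch q (x * q ^ N) k) \<le> K1 * K2"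
      unfolding eq norm_mult by (intro mult_mono K1 K2) (use K1 in auto)
    have "norm (inverse (qpoch q (x * q ^ N) k)) = norm (qpoch q x N) * norm (inverse (qpoch q x (N + k)))"
      unfolding eq by (simp add: norm_divide divide_inverse norm_inverse norm_mult mult.commute)
    also have "\<dots> \<le> K1 * K2"
      by (intro mult_mono K1 K2) (use K1 in auto)
    finally show "norm (inverse (qpoch q (x * q ^ N) k)) \<le> K1 * K2" .
  qed
qed

section \<open>The nonterminating very-well-poised sum\<close>

text \<open>The summand of a very-well-poised \<open>\<^sub>6\<phi>\<^sub>5\<close> without its factor \<open>1 - A q\<^sup>2\<^sup>k\<close>.
  Parametrising by the argument \<open>z\<close> and \<open>b, c, d\<close> subject to \<open>A q = b c d z\<close> turns the
  lower parameters \<open>A q / b\<close>, \<open>A q / c\<close>, \<open>A q / d\<close> into products.\<close>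

definition vwp_coeff :: "complex \<Rightarrow> complex \<Rightarrow> complex \<Rightarrow> complex \<Rightarrow> complex \<Rightarrow> complex \<Rightarrow> nat \<Rightarrow> complex" where
  "vwp_coeff q A b c d z k =
     qpoch q A k * qpoch q b k * qpoch q c k * qpoch q d k
     / ((1 - A) * qpoch q q k * qpoch q (c*d*z) k * qpoch q (b*d*z) k * qpoch q (b*c*z) k) * z ^ k"

text \<open>With the division by \<open>1 - A\<close> in \<open>vwp_coeff\<close>, the last factor
  is the very-well-poised quotient of \<open>q sqrt A\<close>, \<open>-q sqrt A\<close> over
  \<open>sqrt A\<close>, \<open>-sqrt A\<close>, freed of roots.\<close>

definition vwp_term :: "complex \<Rightarrow> complex \<Rightarrow> complex \<Rightarrow> complex \<Rightarrow> complex \<Rightarrow> complex \<Rightarrow> nat \<Rightarrow> complex" where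
  "vwp_term q A b c d z k = vwp_coeff q A b c d z k * (1 - A * q ^ (2 * k))"

text \<open>The quotient of the product side of the sum at \<open>(A, z)\<close> by that at
  \<open>(A q, z q)\<close>; balancing makes \<open>1 - b*c*d*z\<close> equal to
  \<open>1 - A*q\<close>.\<close>

definition vwp_ratio :: "complex \<Rightarrow> complex \<Rightarrow> complex \<Rightarrow> complex \<Rightarrow> complex" where
  "vwp_ratio b c d z =
     (1 - b*c*d*z) * (1 - b*z) * (1 - c*z) * (1 - d*z)
     / ((1 - c*d*z) * (1 - b*d*z) * (1 - b*c*z) * (1 - z))"

text \<open>With \<open>Q = q\<^sup>k\<close>, this is the \<open>q\<close>-Zeilberger certificate for the recurrence under
  \<open>A \<mapsto> A q\<close>, \<open>z \<mapsto> z q\<close>, cleared of denominators.\<close>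

lemma vwp_certificate_identity:
  fixes A b c d z Q :: complex
  shows "(1 - z) * (1 - A*Q^2) * ((1 - c*d*z*Q) * (1 - b*d*z*Q) * (1 - b*c*z*Q))
       - (1 - b*c*d*z*Q^2) * (1 - A*Q) * Q * ((1 - b*z) * (1 - c*z) * (1 - d*z))
     = (1 - Q) * (1 - A*z*Q) * ((1 - c*d*z*Q) * (1 - b*d*z*Q) * (1 - b*c*z*Q))
       - (1 - A*Q) * (1 - b*Q) * (1 - c*Q) * (1 - d*Q) * z * (1 - b*c*d*z^2*Q)"
  by algebra

locale vwp =
  fixes q A b c d z :: complex
  assumes q: "0 < norm q" "norm q < 1"
    and balanced: "A * q = b * c * d * z"
    and z: "norm z < 1"
    and A_ne: "\<And>j. A * q ^ j \<noteq> 1"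
    and cdz_ne: "\<And>j. c*d*z * q ^ j \<noteq> 1"
    and bdz_ne: "\<And>j. b*d*z * q ^ j \<noteq> 1"
    and bcz_ne: "\<And>j. b*c*z * q ^ j \<noteq> 1"
begin

lemma q_ne: "q * q ^ j \<noteq> 1"
  by (rule norm_less_one_power_ne_one) (use q in auto)

lemma nonzero_factors:
  "1 - A \<noteq> 0" "1 - A * q \<noteq> 0" "1 - z \<noteq> 0"
  using A_ne[of 0] A_ne[of 1] z by auto

lemma nonzero_qpochs:
  "qpoch q A k \<noteq> 0" "qpoch q (c*d*z) k \<noteq> 0" "qpoch q (b*d*z) k \<noteq> 0" "qpoch q (b*c*z) k \<noteq> 0"
  "qpoch q q k \<noteq> 0"
  using A_ne cdz_ne bdz_ne bcz_ne q_ne by (auto simp: qpoch_nonzero_iff)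

lemma vwp_coeff_Suc:
  "vwp_coeff q A b c d z (Suc k) = vwp_coeff q A b c d z k *
     ((1 - A * q^k) * (1 - b * q^k) * (1 - c * q^k) * (1 - d * q^k) * z
      / ((1 - q * q^k) * (1 - c*d*z * q^k) * (1 - b*d*z * q^k) * (1 - b*c*z * q^k)))"
  by (simp add: vwp_coeff_def qpoch_Suc mult_ac)

text \<open>Three factors in the denominator of \<open>vwp_ratio\<close> bring the lower
  \<open>(x q)_k\<close> back to \<open>(x)_k\<close> by \<open>qpoch_shift\<close>, so both sides
  of the recurrence share the factor \<open>vwp_coeff q A b c d z k\<close>.\<close>

lemma vwp_term_shift:
  "vwp_ratio b c d z * vwp_term q (A * q) b c d (z * q) k =
     vwp_coeff q A b c d z k *
     ((1 - b*c*d*z * (q^k)^2) * (1 - A * q^k) * q^k * ((1 - b*z) * (1 - c*z) * (1 - d*z))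
      / ((1 - z) * ((1 - c*d*z * q^k) * (1 - b*d*z * q^k) * (1 - b*c*z * q^k))))"
proof -
  have 1: "c*d*(z*q) = c*d*z*q" "b*d*(z*q) = b*d*z*q" "b*c*(z*q) = b*c*z*q"
    by simp_all
  have 2: "1 - A * q * q ^ (2*k) = 1 - b*c*d*z * (q^k)^2"
    by (simp add: balanced power_mult mult.commute[of 2])
  have 3: "qpoch q (A * q) k = qpoch q A k * (1 - A * q^k) / (1 - A)"
    using qpoch_shift[of A q k] nonzero_factors(1) by (simp add: eq_divide_eq mult.commute)
  have gen: "P * u1 * u2 * u3 / (D1 * D2 * D3 * D4) * (X * B * C * D / (P * R * E1 * E2 * E3) * (zk * Q) * S)
     = X * B * C * D / (R * (D1 * E1) * (D2 * E2) * (D3 * E3)) * zk * (S * Q * (u1 * u2 * u3) / D4)"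
    if "P \<noteq> 0" for P u1 u2 u3 D1 D2 D3 D4 X B C D R E1 E2 E3 zk Q S :: complex
  proof -
    have "P * u1 * u2 * u3 / (D1 * D2 * D3 * D4) * (X * B * C * D / (P * R * E1 * E2 * E3) * (zk * Q) * S)
      = (P * (u1 * u2 * u3 * X * B * C * D * zk * Q * S)) / (P * (D1 * D2 * D3 * D4 * R * E1 * E2 * E3))"
      by (simp add: mult_ac)
    also have "\<dots> = (u1 * u2 * u3 * X * B * C * D * zk * Q * S) / (D1 * D2 * D3 * D4 * R * E1 * E2 * E3)"
      using that by simp
    finally show ?thesis by (simp add: mult_ac)
  qed
  have "vwp_ratio b c d z * vwp_term q (A * q) b c d (z * q) k =
      qpoch q (A * q) k * qpoch q b k * qpoch q c k * qpoch q d k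
      / (qpoch q q k * ((1 - c*d*z) * qpoch q (c*d*z*q) k) * ((1 - b*d*z) * qpoch q (b*d*z*q) k)
         * ((1 - b*c*z) * qpoch q (b*c*z*q) k)) * z^k
      * ((1 - b*c*d*z * (q^k)^2) * q^k * ((1 - b*z) * (1 - c*z) * (1 - d*z)) / (1 - z))"
    unfolding vwp_term_def vwp_coeff_def vwp_ratio_def 1 2 power_mult_distrib balanced[symmetric]
    by (rule gen[OF nonzero_factors(2)])
  also have "\<dots> = vwp_coeff q A b c d z k *
     ((1 - b*c*d*z * (q^k)^2) * (1 - A * q^k) * q^k * ((1 - b*z) * (1 - c*z) * (1 - d*z))
      / ((1 - z) * ((1 - c*d*z * q^k) * (1 - b*d*z * q^k) * (1 - b*c*z * q^k))))"
    unfolding qpoch_shift 3 vwp_coeff_def by (simp add: mult_ac)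
  finally show ?thesis .
qed

text \<open>The antidifference of the q-Zeilberger method: a rational function of \<open>q^k\<close>
  times the coefficient, with \<open>1 - q^k\<close> making it vanish at the lower end.\<close>

definition vwp_cert :: "nat \<Rightarrow> complex" where
  "vwp_cert k = - vwp_coeff q A b c d z k * (1 - q^k) * (1 - A*z * q^k) / (1 - z)"

lemma vwp_telescope:
  "vwp_term q A b c d z k - vwp_ratio b c d z * vwp_term q (A * q) b c d (z * q) k = vwp_cert (Suc k) - vwp_cert k"
proof -
  define Q where "Q = q^k"
  define W where "W = vwp_coeff q A b c d z k"
  define P where "P = (1 - c*d*z*Q) * (1 - b*d*z*Q) * (1 - b*c*z*Q)"
  have nz: "P \<noteq> 0" "1 - z \<noteq> 0" "1 - q * Q \<noteq> 0"
    using nonzero_factors(3) cdz_ne[of k] bdz_ne[of k] bcz_ne[of k] q_ne[of k]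
    by (auto simp: P_def Q_def)
  define E where "E = (1 - z) * P"
  have E: "E \<noteq> 0" using nz by (simp add: E_def)
  define M1 where "M1 = (1 - b*c*d*z*Q^2) * (1 - A*Q) * Q * ((1 - b*z) * (1 - c*z) * (1 - d*z))"
  define M2 where "M2 = (1 - A*Q) * (1 - b*Q) * (1 - c*Q) * (1 - d*Q) * z"
  define M3 where "M3 = 1 - b*c*d*z^2*Q"
  have Q2: "q ^ (2 * k) = Q^2"
    by (simp add: Q_def power_even_eq)
  have "vwp_term q A b c d z k - vwp_ratio b c d z * vwp_term q (A * q) b c d (z * q) k
      = W * (1 - A*Q^2) - W * (M1 / E)"
    unfolding vwp_term_shift unfolding vwp_term_def Q2 M1_def E_def P_def W_def Q_def ..
  also have "\<dots> = W * ((1 - A*Q^2) * E - M1) / E"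
    using E by (simp add: right_diff_distrib diff_divide_distrib)
  also have "(1 - A*Q^2) * E - M1 = (1 - Q) * (1 - A*z*Q) * P - M2 * M3"
    using vwp_certificate_identity[where z=z and A=A and Q=Q and b=b and c=c and d=d, folded P_def]
    by (simp add: E_def M1_def M2_def M3_def mult_ac)
  finally have lhs: "vwp_term q A b c d z k - vwp_ratio b c d z * vwp_term q (A * q) b c d (z * q) k
      = W * ((1 - Q) * (1 - A*z*Q) * P - M2 * M3) / E" .
  \<comment> \<open>Balancing rewrites \<open>A z q^(k+1)\<close> as \<open>b c d z^2 q^k\<close>,
    the form in the polynomial identity.\<close>
  have M3': "1 - A * z * q ^ Suc k = M3"
    using balanced by (simp add: M3_def Q_def power2_eq_square mult_ac)
  have rearrange: "- (W * (M2 / (x * P))) * x * M3 / y = - W * (M2 * M3) / (y * P)" if "x \<noteq> 0" for x y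
    using that by (simp add: mult_ac)
  have Suc: "vwp_cert (Suc k) = - W * (M2 * M3) / E"
    unfolding vwp_cert_def vwp_coeff_Suc M3' E_def
    using rearrange[OF nz(3)] by (simp add: W_def M2_def P_def Q_def mult.assoc)
  have "vwp_cert k = - W * ((1 - Q) * (1 - A*z*Q) * P) / E"
    using nz by (simp add: vwp_cert_def W_def Q_def E_def)
  then show ?thesis
    unfolding lhs Suc by (simp add: diff_divide_distrib right_diff_distrib)
qed

lemma vwp_cert_0: "vwp_cert 0 = 0"
  by (simp add: vwp_cert_def)

text \<open>A geometric majorant independent of \<open>N\<close> gives both summability (at
  \<open>N = 0\<close>) and the interchange of limit and sum.\<close>

lemma vwp_term_shift_bound:
  "\<exists>K>0. \<forall>N k. norm (vwp_term q (A * q^N) b c d (z * q^N) k) \<le> K * norm z ^ k"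
proof -
  obtain KA where KA: "KA > 0" "\<And>N k. norm (qpoch q (A * q^N) k) \<le> KA"
      "\<And>N k. norm (inverse (qpoch q (A * q^N) k)) \<le> KA"
    using qpoch_uniformly_bounded[OF q(2), of A] A_ne by blast
  obtain Kb where Kb: "Kb > 0" "\<And>k. norm (qpoch q b k) \<le> Kb"
    using qpoch_bounded[OF q(2), of b] by blast
  obtain Kc where Kc: "Kc > 0" "\<And>k. norm (qpoch q c k) \<le> Kc"
    using qpoch_bounded[OF q(2), of c] by blast
  obtain Kd where Kd: "Kd > 0" "\<And>k. norm (qpoch q d k) \<le> Kd"
    using qpoch_bounded[OF q(2), of d] by blast
  obtain L where L: "L > 0" "\<And>k. norm (inverse (qpoch q q k)) \<le> L"
    using qpoch_uniformly_bounded[OF q(2), of q] q_ne by (metis mult_1_right power_0)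
  obtain Lb where Lb: "Lb > 0" "\<And>N k. norm (inverse (qpoch q (c*d*z * q^N) k)) \<le> Lb"
    using qpoch_uniformly_bounded[OF q(2), of "c*d*z"] cdz_ne by blast
  obtain Lc where Lc: "Lc > 0" "\<And>N k. norm (inverse (qpoch q (b*d*z * q^N) k)) \<le> Lc"
    using qpoch_uniformly_bounded[OF q(2), of "b*d*z"] bdz_ne by blast
  obtain Ld where Ld: "Ld > 0" "\<And>N k. norm (inverse (qpoch q (b*c*z * q^N) k)) \<le> Ld"
    using qpoch_uniformly_bounded[OF q(2), of "b*c*z"] bcz_ne by blast
  have q_pow: "norm (q ^ j) \<le> 1" for j
    using q by (simp add: norm_power power_le_one)
  show ?thesis
  proof (intro exI conjI allI)
    fix N k
    have "norm (1 - A * q^N * q ^ (2*k)) \<le> 1 + norm (A * q ^ (N + 2*k))"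
      using norm_triangle_ineq4[of 1 "A * q^N * q ^ (2*k)"] by (simp add: power_add mult.assoc)
    also have "\<dots> \<le> 1 + norm A"
      using mult_left_mono[OF q_pow[of "N + 2*k"] norm_ge_zero[of A]] by (simp add: norm_mult)
    finally have KA': "norm (1 - A * q^N * q ^ (2*k)) \<le> 1 + norm A" .
    \<comment> \<open>\<open>1 - A q^N\<close> is a shifted factorial of length 1, so the uniform
      bound for \<open>A\<close> covers it.\<close>
    have inv_A: "norm (inverse (1 - A * q^N)) \<le> KA"
      using KA(3)[of N 1] by (simp add: qpoch_Suc)
    have z_pow: "norm ((z * q^N) ^ k) \<le> norm z ^ k"
      using mult_left_mono[OF q_pow[of "N * k"], of "norm z ^ k"]
      by (simp add: power_mult_distrib norm_mult norm_power power_mult)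
    have assoc: "c*d*(z*q^N) = c*d*z*q^N" "b*d*(z*q^N) = b*d*z*q^N" "b*c*(z*q^N) = b*c*z*q^N"
      by simp_all
    have eq: "vwp_term q (A * q^N) b c d (z * q^N) k =
       qpoch q (A * q^N) k * qpoch q b k * qpoch q c k * qpoch q d k
       * inverse (1 - A * q^N) * inverse (qpoch q q k)
       * inverse (qpoch q (c*d*z * q^N) k) * inverse (qpoch q (b*d*z * q^N) k)
       * inverse (qpoch q (b*c*z * q^N) k) * (1 - A * q^N * q ^ (2*k)) * (z * q^N) ^ k"
      unfolding vwp_term_def vwp_coeff_def divide_inverse inverse_mult_distrib assoc by (simp only: mult_ac)
    show "norm (vwp_term q (A * q^N) b c d (z * q^N) k) \<le>
        KA * Kb * Kc * Kd * KA * L * Lb * Lc * Ld * (1 + norm A) * norm z ^ k"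
      unfolding eq norm_mult
      by (intro mult_mono KA Kb Kc Kd L Lb Lc Ld KA' inv_A z_pow[unfolded norm_mult])
         (use KA(1) Kb(1) Kc(1) Kd(1) L(1) Lb(1) Lc(1) Ld(1) in auto)
    show "KA * Kb * Kc * Kd * KA * L * Lb * Lc * Ld * (1 + norm A) > 0"
      using KA(1) Kb(1) Kc(1) Kd(1) L(1) Lb(1) Lc(1) Ld(1) by (simp add: add_pos_nonneg)
  qed
qed

lemma summable_vwp_term: "summable (vwp_term q A b c d z)"
proof -
  obtain K where K: "\<And>N k. norm (vwp_term q (A * q^N) b c d (z * q^N) k) \<le> K * norm z ^ k"
    using vwp_term_shift_bound by blast
  show ?thesis
  proof (rule summable_comparison_test')
    show "summable (\<lambda>k. K * norm z ^ k)"
      using z by (intro summable_mult summable_geometric) simp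
    show "norm (vwp_term q A b c d z k) \<le> K * norm z ^ k" for k
      using K[of 0 k] by simp
  qed
qed

lemma vwp_term_limit: "(\<lambda>N. \<Sum>k. vwp_term q (A * q^N) b c d (z * q^N) k) \<longlonglongrightarrow> 1"
proof -
  obtain K where K: "\<And>N k. norm (vwp_term q (A * q^N) b c d (z * q^N) k) \<le> K * norm z ^ k"
    using vwp_term_shift_bound by blast
  \<comment> \<open>The termwise limit: \<open>z q^N\<close> tends to 0, and \<open>0 ^ k\<close>
    leaves only the term \<open>k = 0\<close>, which is 1.\<close>
  define lim where "lim k = qpoch q b k * qpoch q c k * qpoch q d k / qpoch q q k * (0::complex) ^ k" for k
  have assoc: "c*d*(z*q^N) = c*d*z*q^N" "b*d*(z*q^N) = b*d*z*q^N" "b*c*(z*q^N) = b*c*z*q^N" for N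
    by simp_all
  have lim: "(\<lambda>N. vwp_term q (A * q^N) b c d (z * q^N) k) \<longlonglongrightarrow> lim k" for k
  proof -
    have "(\<lambda>N. vwp_term q (A * q^N) b c d (z * q^N) k) \<longlonglongrightarrow>
       1 * qpoch q b k * qpoch q c k * qpoch q d k / ((1 - A * 0) * qpoch q q k * 1 * 1 * 1) * (z * 0) ^ k
       * (1 - A * 0 * q ^ (2*k))"
      unfolding vwp_term_def vwp_coeff_def assoc
      by (intro tendsto_intros qpoch_power_tendsto_1 LIMSEQ_power_zero) (use q nonzero_qpochs in auto)
    then show ?thesis by (simp add: lim_def)
  qed
  have "(\<lambda>N. \<Sum>k. vwp_term q (A * q^N) b c d (z * q^N) k) \<longlonglongrightarrow> (\<Sum>k. lim k)"
  proof (rule conjunct2[OF conjunct2[OF tannerys_theorem]])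
    show "summable (\<lambda>k. K * norm z ^ k)"
      using z by (intro summable_mult summable_geometric) simp
    show "\<forall>\<^sub>F (k, N) in at_top \<times>\<^sub>F sequentially.
        norm (vwp_term q (A * q^N) b c d (z * q^N) k) \<le> K * norm z ^ k"
      using K by (intro always_eventually) auto
  qed (use lim in auto)
  also have "(\<Sum>k. lim k) = 1"
    unfolding lim_def by (subst powser_zero) simp
  finally show ?thesis .
qed

lemma vwp_cert_tendsto_0: "vwp_cert \<longlonglongrightarrow> 0"
proof -
  have "qpoch_inf q (c*d*z) \<noteq> 0" "qpoch_inf q (b*d*z) \<noteq> 0" "qpoch_inf q (b*c*z) \<noteq> 0" "qpoch_inf q q \<noteq> 0"
    by (intro qpoch_inf_nonzero q cdz_ne bdz_ne bcz_ne q_ne)+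
  then have "vwp_cert \<longlonglongrightarrow>
      - (qpoch_inf q A * qpoch_inf q b * qpoch_inf q c * qpoch_inf q d
       / ((1 - A) * qpoch_inf q q * qpoch_inf q (c*d*z) * qpoch_inf q (b*d*z) * qpoch_inf q (b*c*z)) * 0)
       * (1 - 0) * (1 - A*z * 0) / (1 - z)"
    unfolding vwp_cert_def vwp_coeff_def
    by (intro tendsto_intros qpoch_tendsto_inf LIMSEQ_power_zero) (use q z nonzero_factors in auto)
  then show ?thesis by simp
qed

lemma vwp_shift: "vwp q (A * q) b c d (z * q)"
proof
  show "norm (z * q) < 1"
    using mult_strict_mono'[of "norm z" 1 "norm q" 1] q z by (simp add: norm_mult)
  show "A * q * q = b * c * d * (z * q)"
    using balanced by simp
  show "A * q * q ^ j \<noteq> 1" for j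
    using A_ne[of "Suc j"] by (simp add: mult_ac)
  show "c*d*(z*q) * q ^ j \<noteq> 1" for j
    using cdz_ne[of "Suc j"] by (simp add: mult_ac)
  show "b*d*(z*q) * q ^ j \<noteq> 1" for j
    using bdz_ne[of "Suc j"] by (simp add: mult_ac)
  show "b*c*(z*q) * q ^ j \<noteq> 1" for j
    using bcz_ne[of "Suc j"] by (simp add: mult_ac)
qed (use q in auto)

lemma vwp_recursion:
  "(\<Sum>k. vwp_term q A b c d z k) = vwp_ratio b c d z * (\<Sum>k. vwp_term q (A * q) b c d (z * q) k)"
proof -
  interpret shifted: vwp q "A * q" b c d "z * q"
    by (rule vwp_shift)
  have "(\<lambda>k. vwp_cert (Suc k) - vwp_cert k) sums (0 - vwp_cert 0)"
    by (rule telescope_sums[OF vwp_cert_tendsto_0])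
  then have "(\<lambda>k. vwp_term q A b c d z k - vwp_ratio b c d z * vwp_term q (A * q) b c d (z * q) k) sums 0"
    by (simp add: vwp_telescope vwp_cert_0)
  moreover have "(\<lambda>k. vwp_term q A b c d z k - vwp_ratio b c d z * vwp_term q (A * q) b c d (z * q) k) sums
     ((\<Sum>k. vwp_term q A b c d z k) - vwp_ratio b c d z * (\<Sum>k. vwp_term q (A * q) b c d (z * q) k))"
    by (intro sums_diff sums_mult summable_sums summable_vwp_term shifted.summable_vwp_term)
  ultimately show ?thesis
    using sums_unique2 by fastforce
qed

end

text \<open>The recurrence changes \<open>A\<close> and \<open>z\<close> together, so both vary in
  the induction; its ratios multiply up to shifted factorials of length \<open>N\<close>.\<close>

lemma vwp_iterate:
  assumes "vwp q A b c d z"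
  shows "(\<Sum>k. vwp_term q A b c d z k) =
     qpoch q (A*q) N * qpoch q (b*z) N * qpoch q (c*z) N * qpoch q (d*z) N
     / (qpoch q (c*d*z) N * qpoch q (b*d*z) N * qpoch q (b*c*z) N * qpoch q z N)
     * (\<Sum>k. vwp_term q (A * q^N) b c d (z * q^N) k)"
  using assms
proof (induction N arbitrary: A z)
  case (Suc N)
  interpret vwp q A b c d z by fact
  show ?case
    unfolding vwp_recursion Suc.IH[OF vwp_shift]
    by (simp add: vwp_ratio_def qpoch_Suc_left balanced[symmetric, unfolded mult.assoc] mult_ac)
qed simp

text \<open>The left side of \<open>vwp_iterate\<close> does not depend on \<open>N\<close>; as
  \<open>N\<close> grows, the finite products become infinite ones and the remaining series tends to
  1.\<close>

theorem vwp_sums: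
  assumes "vwp q A b c d z"
  shows "vwp_term q A b c d z sums
     (qpoch_inf q (A*q) * qpoch_inf q (b*z) * qpoch_inf q (c*z) * qpoch_inf q (d*z)
      / (qpoch_inf q (c*d*z) * qpoch_inf q (b*d*z) * qpoch_inf q (b*c*z) * qpoch_inf q z))"
proof -
  interpret vwp q A b c d z by fact
  have z_ne: "z * q ^ j \<noteq> 1" for j
    by (rule norm_less_one_power_ne_one[OF q(2) z])
  have "qpoch_inf q (c*d*z) \<noteq> 0" "qpoch_inf q (b*d*z) \<noteq> 0" "qpoch_inf q (b*c*z) \<noteq> 0" "qpoch_inf q z \<noteq> 0"
    by (intro qpoch_inf_nonzero q cdz_ne bdz_ne bcz_ne z_ne)+
  then have "(\<lambda>N. qpoch q (A*q) N * qpoch q (b*z) N * qpoch q (c*z) N * qpoch q (d*z) N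
     / (qpoch q (c*d*z) N * qpoch q (b*d*z) N * qpoch q (b*c*z) N * qpoch q z N)
     * (\<Sum>k. vwp_term q (A * q^N) b c d (z * q^N) k)) \<longlonglongrightarrow>
     qpoch_inf q (A*q) * qpoch_inf q (b*z) * qpoch_inf q (c*z) * qpoch_inf q (d*z)
      / (qpoch_inf q (c*d*z) * qpoch_inf q (b*d*z) * qpoch_inf q (b*c*z) * qpoch_inf q z) * 1"
    by (intro tendsto_intros qpoch_tendsto_inf vwp_term_limit q) auto
  then have "(\<lambda>N::nat. \<Sum>k. vwp_term q A b c d z k) \<longlonglongrightarrow>
     qpoch_inf q (A*q) * qpoch_inf q (b*z) * qpoch_inf q (c*z) * qpoch_inf q (d*z)
      / (qpoch_inf q (c*d*z) * qpoch_inf q (b*d*z) * qpoch_inf q (b*c*z) * qpoch_inf q z)"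
    unfolding vwp_iterate[OF assms, symmetric] by simp
  then have "(\<Sum>k. vwp_term q A b c d z k) =
     qpoch_inf q (A*q) * qpoch_inf q (b*z) * qpoch_inf q (c*z) * qpoch_inf q (d*z)
      / (qpoch_inf q (c*d*z) * qpoch_inf q (b*d*z) * qpoch_inf q (b*c*z) * qpoch_inf q z)"
    by (simp add: LIMSEQ_const_iff)
  then show ?thesis
    using summable_sums[OF summable_vwp_term] by simp
qed

section \<open>The Saalschuetz sum\<close>

text \<open>The \<open>q\<close>-Pfaff--Saalschuetz sum, with \<open>(q\<^sup>-\<^sup>n)\<^sub>j / (q\<^sup>1\<^sup>-\<^sup>n / x)\<^sub>j\<close> rewritten as
  a quotient of \<open>(x)\<^sub>n\<^sub>-\<^sub>j\<close> and \<open>(q)\<^sub>n\<^sub>-\<^sub>j\<close> so that no negative powers occur.\<close>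

definition saal_term :: "complex \<Rightarrow> complex \<Rightarrow> complex \<Rightarrow> complex \<Rightarrow> nat \<Rightarrow> nat \<Rightarrow> complex" where
  "saal_term q a b x n j =
     qpoch q a j * qpoch q b j * x ^ j * qpoch q x (n - j)
     / (qpoch q q j * qpoch q (a*b*x) j * qpoch q q (n - j))"

text \<open>With \<open>Q = q^j\<close> and \<open>R = q^(n-j)\<close>, hence
  \<open>q^n = Q R\<close>, this is the q-Zeilberger certificate for the recurrence in
  \<open>n\<close>, stripped of a common factor.\<close>

lemma saal_certificate:
  fixes a b x Q R q :: complex
  shows "(1 - q*(Q*R)) * (1 - a*b*x*(Q*R)) * (1 - x*R) - (1 - b*x*(Q*R)) * (1 - a*x*(Q*R)) * (1 - q*R)
     = x * (1 - a*Q) * (1 - b*Q) * (1 - q*R) * (- R)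
       - (1 - x*R) * (1 - Q) * (q - a*b*x*Q) * (- R)"
  by algebra

lemma saal_recursion:
  assumes q: "0 < norm q" "norm q < 1" and c: "qpoch q (a*b*x) (Suc n) \<noteq> 0"
  shows "(1 - q * q^n) * (1 - a*b*x * q^n) * (\<Sum>j\<le>Suc n. saal_term q a b x (Suc n) j)
       = (1 - b*x * q^n) * (1 - a*x * q^n) * (\<Sum>j\<le>n. saal_term q a b x n j)"
proof -
  have qn: "q * q ^ j \<noteq> 1" for j
    by (rule norm_less_one_power_ne_one) (use q in auto)
  then have qj: "qpoch q q j \<noteq> 0" for j
    by (simp add: qpoch_nonzero_iff)
  have cj: "qpoch q (a*b*x) j \<noteq> 0" "a*b*x * q^j \<noteq> 1" if "j \<le> n" for j
    using c that by (auto simp: qpoch_nonzero_iff)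
  \<comment> \<open>The antidifference in \<open>j\<close>. Its power of \<open>q\<close> is
    \<open>q R\<close>; the extra \<open>q\<close> turns \<open>1 - a b x q^(j-1)\<close> into the
    factor \<open>q - a b x Q\<close> of \<open>saal_certificate\<close>.\<close>
  define H where "H j = (if j = 0 then 0 else
      saal_term q a b x (Suc n) j * (1 - q^j) * (1 - a*b*x * q^(j - 1)) * (- (q ^ (Suc n - j))))" for j
  have step: "(1 - q * q^n) * (1 - a*b*x * q^n) * saal_term q a b x (Suc n) j
      - (1 - b*x * q^n) * (1 - a*x * q^n) * saal_term q a b x n j = H (Suc j) - H j" if "j \<le> n" for j
  proof -
    define R Q where "R = q ^ (n - j)" and "Q = q ^ j"
    have N: "q^n = Q * R"
      using that by (simp add: Q_def R_def flip: power_add)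
    \<comment> \<open>Taking \<open>Suc (n - j)\<close> in the last factorial makes the terms for
      \<open>n\<close> and \<open>n + 1\<close> both polynomial multiples of
      \<open>B\<close>.\<close>
    define B where "B = qpoch q a j * qpoch q b j * x ^ j * qpoch q x (n - j)
       / (qpoch q q j * qpoch q (a*b*x) j * qpoch q q (Suc (n - j)))"
    have nz: "1 - q * R \<noteq> 0" "1 - q * Q \<noteq> 0" "1 - a*b*x*Q \<noteq> 0" "qpoch q q (n - j) \<noteq> 0"
      using qn[of "n - j"] qn[of j] cj(2)[OF that] qj by (auto simp: R_def Q_def)
    have S: "Suc n - j = Suc (n - j)" using that by simp
    have T0: "saal_term q a b x n j = B * (1 - q * R)"
      using nz by (simp add: saal_term_def B_def qpoch_Suc R_def mult_ac)
    have T1: "saal_term q a b x (Suc n) j = B * (1 - x * R)"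
      by (simp add: saal_term_def B_def S qpoch_Suc[of q x] R_def mult_ac)
    have "saal_term q a b x (Suc n) (Suc j) * ((1 - q * Q) * (1 - a*b*x * Q))
        = B * ((1 - a*Q) * (1 - b*Q) * x * (1 - q * R))"
      using nz by (simp add: saal_term_def B_def qpoch_Suc R_def Q_def)
    then have HS: "H (Suc j) = B * (x * (1 - a*Q) * (1 - b*Q) * (1 - q*R) * (- R))"
      by (simp add: H_def Q_def[symmetric] R_def[symmetric] mult_ac)
    have Hj: "H j = B * ((1 - x*R) * (1 - Q) * (q - a*b*x*Q) * (- R))"
    proof (cases "j = 0")
      case True
      then show ?thesis by (simp add: H_def Q_def)
    next
      case False
      then have c: "q - a*b*x*Q = q * (1 - a*b*x * q ^ (j - 1))"
        by (cases j) (simp_all add: Q_def algebra_simps)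
      have "H j = saal_term q a b x (Suc n) j * (1 - Q) * (1 - a*b*x * q ^ (j - 1)) * (- (q * R))"
        using False by (simp add: H_def S Q_def R_def)
      then show ?thesis
        unfolding T1 c by (simp add: mult_ac)
    qed
    show ?thesis
      unfolding T0 T1 HS Hj N using saal_certificate[of q Q R a b x]
      by (metis (no_types, lifting) mult.left_commute right_diff_distrib)
  qed
  have "(\<Sum>j\<le>n. (1 - q * q^n) * (1 - a*b*x * q^n) * saal_term q a b x (Suc n) j
      - (1 - b*x * q^n) * (1 - a*x * q^n) * saal_term q a b x n j) = (\<Sum>j\<le>n. H (Suc j) - H j)"
    by (intro sum.cong refl step) simp
  also have "\<dots> = H (Suc n)"
    using sum_lessThan_telescope[of H "Suc n"]
    by (simp add: H_def lessThan_Suc_atMost)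
  \<comment> \<open>At \<open>j = n + 1\<close> the power of \<open>q\<close> is 1, so the boundary
    value is minus the top summand still missing from the longer sum.\<close>
  also have "H (Suc n) = - ((1 - q * q^n) * (1 - a*b*x * q^n) * saal_term q a b x (Suc n) (Suc n))"
    by (simp add: H_def)
  finally have telescoped: "(1 - q * q^n) * (1 - a*b*x * q^n) * (\<Sum>j\<le>n. saal_term q a b x (Suc n) j)
      - (1 - b*x * q^n) * (1 - a*x * q^n) * (\<Sum>j\<le>n. saal_term q a b x n j)
      = - ((1 - q * q^n) * (1 - a*b*x * q^n) * saal_term q a b x (Suc n) (Suc n))"
    by (simp only: sum_subtractf sum_distrib_left[symmetric])
  have "u + t = v" if "u - v = - t" for u v t :: complex
    using that by (simp add: diff_eq_eq)
  from this[OF telescoped] show ?thesis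
    by (simp only: sum.atMost_Suc distrib_left)
qed

text \<open>\<open>saal_recursion\<close> determines the sum from \<open>n = 0\<close>. In the usual
  notation \<open>c = a b x\<close>, so \<open>a x\<close> and \<open>b x\<close> are
  \<open>c/b\<close> and \<open>c/a\<close>.\<close>

theorem saalschuetz:
  assumes q: "0 < norm q" "norm q < 1" and c: "qpoch q (a*b*x) n \<noteq> 0"
  shows "(\<Sum>j\<le>n. saal_term q a b x n j)
       = qpoch q (a*x) n * qpoch q (b*x) n / (qpoch q q n * qpoch q (a*b*x) n)"
  using c
proof (induction n)
  case 0
  show ?case by (simp add: saal_term_def)
next
  case (Suc n)
  have cn: "qpoch q (a*b*x) n \<noteq> 0" "1 - a*b*x * q^n \<noteq> 0"
    using Suc.prems by (auto simp: qpoch_Suc)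
  have qn: "1 - q * q ^ n \<noteq> 0" "qpoch q q n \<noteq> 0"
    using norm_less_one_power_ne_one[of q q] qpoch_nonzero_of_norm_less_one[of q q] q by auto
  have "(\<Sum>j\<le>Suc n. saal_term q a b x (Suc n) j)
      = (1 - b*x * q^n) * (1 - a*x * q^n) * (\<Sum>j\<le>n. saal_term q a b x n j)
        / ((1 - q * q^n) * (1 - a*b*x * q^n))"
    using saal_recursion[OF q Suc.prems] cn qn by (simp add: eq_divide_eq mult_ac)
  also have "\<dots> = qpoch q (a*x) (Suc n) * qpoch q (b*x) (Suc n) / (qpoch q q (Suc n) * qpoch q (a*b*x) (Suc n))"
    unfolding Suc.IH[OF cn(1)] by (simp add: qpoch_Suc mult_ac)
  finally show ?case .
qed

section \<open>Reversal of shifted factorials\<close>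

text \<open>Up to a monomial, \<open>(q/x)_k\<close> is \<open>(x/q^k)_k\<close> read backwards; it
  joins with \<open>(x)_j\<close> to \<open>(x/q^k)_(j+k)\<close>, which is split again after
  \<open>j\<close> factors. This trades a shift by \<open>q^(-k)\<close> for one by
  \<open>q^(-j)\<close>.\<close>

lemma qpoch_divide_power:
  assumes "q \<noteq> 0" "x \<noteq> 0"
  shows "qpoch q x j * qpoch q (q/x) k = qpoch q (x / q^k) j * qpoch q (q / (x * q^j)) k * q ^ (j * k)"
proof (induction k)
  case (Suc k)
  have shift: "(1 - x / q ^ Suc k) * qpoch q (x / q^k) j = qpoch q (x / q ^ Suc k) j * (1 - x / q ^ Suc k * q^j)"
    using qpoch_shift[of "x / q ^ Suc k" q j] assms by simp
  have 1: "1 - q/x * q^k = - (q ^ Suc k / x) * (1 - x / q ^ Suc k)"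
    using assms by (simp add: field_simps)
  have 2: "(1 - q / (x * q^j) * q^k) * q^j = - (q ^ Suc k / x) * (1 - x / q ^ Suc k * q^j)"
    using assms by (simp add: field_simps)
  have "qpoch q x j * qpoch q (q/x) (Suc k) = (qpoch q x j * qpoch q (q/x) k) * (1 - q/x * q^k)"
    by (simp add: qpoch_Suc)
  also have "\<dots> = qpoch q (q / (x * q^j)) k * q ^ (j * k) * (- (q ^ Suc k / x)) * ((1 - x / q ^ Suc k) * qpoch q (x / q^k) j)"
    unfolding Suc.IH 1 by (simp only: mult_ac)
  also have "\<dots> = qpoch q (x / q ^ Suc k) j * qpoch q (q / (x * q^j)) k * q ^ (j * k)
      * (- (q ^ Suc k / x) * (1 - x / q ^ Suc k * q^j))"
    unfolding shift by (simp only: mult_ac)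
  also have "\<dots> = qpoch q (x / q ^ Suc k) j * qpoch q (q / (x * q^j)) (Suc k) * q ^ (j * Suc k)"
    unfolding 2[symmetric] by (simp add: qpoch_Suc power_add)
  finally show ?case .
qed simp

text \<open>Read backwards, its factors vanish exactly where those of \<open>(x)_n\<close>
  do.\<close>

lemma qpoch_reverse_nonzero:
  assumes "q \<noteq> 0" "x \<noteq> 0" "\<And>j. x * q ^ j \<noteq> 1"
  shows "qpoch q (q / (x * q^n)) n \<noteq> 0"
proof -
  have "q / (x * q^n) * q^l \<noteq> 1" if "l < n" for l
  proof
    have n: "q^n = q * (q^l * q^(n - Suc l))"
      using that by (simp flip: power_add power_Suc)
    assume "q / (x * q^n) * q^l = 1"
    then have "x * q^(n - Suc l) = 1"
      unfolding n using assms(1,2) by (simp add: field_simps)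
    then show False using assms(3) by blast
  qed
  then show ?thesis by (simp add: qpoch_nonzero_iff)
qed

text \<open>Brings the pair \<open>q^(-n)\<close>, \<open>X\<close> of a terminating series into the
  form of \<open>saal_term\<close>: for \<open>x = q / (X q^n)\<close> the lower parameter here is
  \<open>X\<close>.\<close>

lemma qpoch_reverse_ratio:
  assumes q: "q \<noteq> 0" and q1: "\<And>j. q * q^j \<noteq> 1" and x: "x \<noteq> 0"
    and nz: "qpoch q x n \<noteq> 0" and j: "j \<le> n" and nz': "qpoch q (q / (x * q^n)) n \<noteq> 0"
  shows "qpoch q (1 / q^n) j * q^j / qpoch q (q / (x * q^n)) j
       = qpoch q q n * qpoch q x (n - j) * x^j / (qpoch q q (n - j) * qpoch q x n)"
  using j
proof (induction j)
  case 0
  have "qpoch q q n \<noteq> 0" using q1 by (simp add: qpoch_nonzero_iff)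
  then show ?case using nz by simp
next
  case (Suc j)
  define l where "l = n - Suc j"
  have nj: "n - j = Suc l" and n: "q^n = q * (q^j * q^l)"
    using Suc.prems by (auto simp: l_def simp flip: power_add power_Suc)
  have nzx: "1 - x * q^l \<noteq> 0" "1 - q * q^l \<noteq> 0"
    using nz Suc.prems q1[of l] by (auto simp: qpoch_nonzero_iff l_def)
  have nzj: "1 - q / (x * q^n) * q^j \<noteq> 0"
    using nz' Suc.prems by (auto simp: qpoch_nonzero_iff)
  have cross: "(1 - 1 / q^n * q^j) * q * (1 - x * q^l) = x * (1 - q * q^l) * (1 - q / (x * q^n) * q^j)"
    using q x unfolding n by (simp add: field_simps)
  then have step: "(1 - 1 / q^n * q^j) * q / (1 - q / (x * q^n) * q^j) = x * (1 - q * q^l) / (1 - x * q^l)"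
    using nzx nzj by (simp add: frac_eq_eq)
  have "qpoch q (1 / q^n) (Suc j) * q^Suc j / qpoch q (q / (x * q^n)) (Suc j)
      = (qpoch q (1 / q^n) j * q^j / qpoch q (q / (x * q^n)) j)
        * ((1 - 1 / q^n * q^j) * q / (1 - q / (x * q^n) * q^j))"
    by (simp add: qpoch_Suc mult_ac)
  also have "\<dots> = (qpoch q q n * qpoch q x (Suc l) * x^j / (qpoch q q (Suc l) * qpoch q x n))
        * (x * (1 - q * q^l) / (1 - x * q^l))"
    using Suc by (simp only: step nj Suc_leD)
  also have "\<dots> = qpoch q q n * qpoch q x l * x^Suc j / (qpoch q q l * qpoch q x n)"
    using nzx by (simp add: qpoch_Suc mult_ac)
  finally show ?case by (simp only: l_def)
qed

section \<open>Orthogonality with respect to the moments\<close>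

text \<open>The coefficients of a little q-Jacobi polynomial, common to \<open>U\<close> and
  \<open>V\<close>; the quotients \<open>(X)_k / (y q)_k\<close> below are the moments of its
  weight.\<close>

definition saal_coeff :: "complex \<Rightarrow> complex \<Rightarrow> complex \<Rightarrow> nat \<Rightarrow> nat \<Rightarrow> complex" where
  "saal_coeff q X y n j = qpoch q (y * q^n) j * qpoch q (1 / q^n) j * q^j / (qpoch q X j * qpoch q q j)"

text \<open>After \<open>(X)_(i+j) = (X)_i (X q^i)_j\<close> the sum is a 3phi2 with upper
  parameters \<open>y q^n\<close>, \<open>X q^i\<close>, \<open>q^(-n)\<close> and lower ones
  \<open>X\<close>, \<open>y q^(i+1)\<close>, which is balanced.\<close>

lemma saal_coeff_moment:
  assumes q: "0 < norm q" "norm q < 1" and X: "X \<noteq> 0" "\<And>j. X * q^j \<noteq> 1"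
    and y: "\<And>j. y * q * q^j \<noteq> 1"
  shows "(\<Sum>j\<le>n. saal_coeff q X y n j * (qpoch q X (i + j) / qpoch q (y*q) (i + j)))
       = qpoch q X i / qpoch q (y*q) i
         * (qpoch q (y*q/X) n * qpoch q (q^Suc i / q^n) n / (qpoch q (q / (X * q^n)) n * qpoch q (y*q^Suc i) n))"
proof -
  define x where "x = q / (X * q^n)"
  have q0: "q \<noteq> 0" using q by auto
  have q1: "q * q^j \<noteq> 1" for j
    by (rule norm_less_one_power_ne_one) (use q in auto)
  have qn: "qpoch q q n \<noteq> 0" using q1 by (simp add: qpoch_nonzero_iff)
  have xn: "qpoch q x n \<noteq> 0"
    unfolding x_def by (rule qpoch_reverse_nonzero[OF q0 X])
  have x0: "x \<noteq> 0" using q0 X by (simp add: x_def)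
  have Xx: "q / (x * q^n) = X" using q0 X by (simp add: x_def)
  have Xn: "qpoch q X j \<noteq> 0" for j using X by (simp add: qpoch_nonzero_iff)
  have abx: "y * q^n * (X * q^i) * x = y * q^Suc i"
    using q0 X by (simp add: x_def)
  have ax: "y * q^n * x = y*q/X" and bx: "X * q^i * x = q^Suc i / q^n"
    using q0 X by (simp_all add: x_def)
  have yn: "qpoch q (y * q^Suc i) n \<noteq> 0"
    using y[of "i + _"] by (auto simp: qpoch_nonzero_iff power_add mult_ac)
  have "saal_coeff q X y n j * (qpoch q X (i + j) / qpoch q (y*q) (i + j))
      = qpoch q X i / qpoch q (y*q) i * (qpoch q q n / qpoch q x n)
        * saal_term q (y * q^n) (X * q^i) x n j" if j: "j \<le> n" for j
  proof -
    have "saal_coeff q X y n j * (qpoch q X (i + j) / qpoch q (y*q) (i + j))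
      = qpoch q X i / qpoch q (y*q) i * (qpoch q (y * q^n) j * qpoch q (X * q^i) j
          / (qpoch q q j * qpoch q (y*q^Suc i) j)) * (qpoch q (1 / q^n) j * q^j / qpoch q X j)"
      by (simp add: saal_coeff_def qpoch_add mult_ac)
    also have "qpoch q (1 / q^n) j * q^j / qpoch q X j
        = qpoch q q n * qpoch q x (n - j) * x^j / (qpoch q q (n - j) * qpoch q x n)"
      using qpoch_reverse_ratio[OF q0 q1 x0 xn j, unfolded Xx, OF Xn] .
    finally show ?thesis
      unfolding saal_term_def abx by (simp add: mult_ac)
  qed
  then have "(\<Sum>j\<le>n. saal_coeff q X y n j * (qpoch q X (i + j) / qpoch q (y*q) (i + j)))
     = qpoch q X i / qpoch q (y*q) i * (qpoch q q n / qpoch q x n)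
        * (\<Sum>j\<le>n. saal_term q (y * q^n) (X * q^i) x n j)"
    by (simp add: sum_distrib_left)
  also have "(\<Sum>j\<le>n. saal_term q (y * q^n) (X * q^i) x n j)
     = qpoch q (y*q/X) n * qpoch q (q^Suc i / q^n) n / (qpoch q q n * qpoch q (y*q^Suc i) n)"
    using saalschuetz[OF q, of "y * q^n" "X * q^i" x n, unfolded abx ax bx, OF yn] .
  finally show ?thesis
    using qn by (simp add: x_def[symmetric] mult_ac)
qed

lemma saal_coeff_moment_eq_0:
  assumes "0 < norm q" "norm q < 1" "X \<noteq> 0" "\<And>j. X * q^j \<noteq> 1" "\<And>j. y * q * q^j \<noteq> 1" and "i < n"
  shows "(\<Sum>j\<le>n. saal_coeff q X y n j * (qpoch q X (i + j) / qpoch q (y*q) (i + j))) = 0"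
proof -
  have "q^Suc i / q^n * q^(n - Suc i) = 1"
    using assms(1,6) by (simp flip: power_add power_Suc)
  moreover have "n - Suc i < n"
    using assms(6) by simp
  ultimately have "qpoch q (q^Suc i / q^n) n = 0"
    using qpoch_nonzero_iff by blast
  then show ?thesis
    unfolding saal_coeff_moment[OF assms(1-5)] by simp
qed

lemma saal_coeff_orthogonal:
  assumes q: "0 < norm q" "norm q < 1" and X: "X \<noteq> 0" "\<And>j. X * q^j \<noteq> 1"
    and y: "\<And>j. y * q * q^j \<noteq> 1" and yn: "y * q^(2*n) \<noteq> 1"
  shows "(\<Sum>j\<le>n. \<Sum>i\<le>m. saal_coeff q X y n j * saal_coeff q X y m i
            * (qpoch q X (i + j) / qpoch q (y*q) (i + j)))
       = (if n = m then X^n * qpoch q q n * qpoch q (y*q/X) n / (qpoch q X n * qpoch q (y*q) n)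
            * ((1 - y * q^n) / (1 - y * q^(2*n))) else 0)"
proof -
  let ?mu = "\<lambda>k. qpoch q X k / qpoch q (y*q) k"
  have q0: "q \<noteq> 0" using q by auto
  have swap: "(\<Sum>j\<le>n. \<Sum>i\<le>m. saal_coeff q X y n j * saal_coeff q X y m i * ?mu (i + j))
      = (\<Sum>i\<le>m. saal_coeff q X y m i * (\<Sum>j\<le>n. saal_coeff q X y n j * ?mu (i + j)))"
    by (subst sum.swap) (simp add: sum_distrib_left mult_ac)
  consider "m < n" | "n < m" | "m = n" by linarith
  then show ?thesis
  proof cases
    case 1
    then show ?thesis
      unfolding swap by (simp add: saal_coeff_moment_eq_0[OF q X y] del: times_divide_eq_right)
  next
    case 2
    \<comment> \<open>The moments depend only on \<open>i + j\<close>, so the vanishing sum can be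
      taken over \<open>i\<close> instead.\<close>
    have "(\<Sum>j\<le>n. \<Sum>i\<le>m. saal_coeff q X y n j * saal_coeff q X y m i * ?mu (i + j))
      = (\<Sum>j\<le>n. saal_coeff q X y n j * (\<Sum>i\<le>m. saal_coeff q X y m i * ?mu (j + i)))"
      by (simp add: sum_distrib_left mult_ac add.commute)
    then show ?thesis
      using 2 by (simp add: saal_coeff_moment_eq_0[OF q X y] del: times_divide_eq_right)
  next
    case 3
    have q1: "q * q^j \<noteq> 1" for j
      by (rule norm_less_one_power_ne_one) (use q in auto)
    have qn: "qpoch q q n \<noteq> 0" using q1 by (simp add: qpoch_nonzero_iff)
    have Xn: "qpoch q X n \<noteq> 0" using X by (simp add: qpoch_nonzero_iff)
    have yn': "qpoch q (y*q) n \<noteq> 0" "qpoch q (y*q^Suc n) n \<noteq> 0"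
      using y y[of "n + _"] by (auto simp: qpoch_nonzero_iff power_add mult_ac)
    define x where "x = q / (X * q^n)"
    have xn: "qpoch q x n \<noteq> 0"
      unfolding x_def by (rule qpoch_reverse_nonzero[OF q0 X])
    have rev: "qpoch q (1 / q^n) n * q^n = qpoch q q n * X^n * qpoch q x n / qpoch q X n"
      using qpoch_reverse_ratio[OF q0 q1 X(1) Xn order_refl, folded x_def, OF xn] xn
      by (simp add: field_simps)
    have sq: "q^(2*n) = q^n * q^n"
      by (simp add: mult_2 power_add)
    \<comment> \<open>The two products share the exponents \<open>n + 1\<close> to
      \<open>2 n - 1\<close>; only the end factors survive.\<close>
    have top: "qpoch q (y * q^n) n / qpoch q (y*q^Suc n) n = (1 - y * q^n) / (1 - y * q^(2*n))"
    proof -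
      have "(1 - y * q^n) * qpoch q (y*q^Suc n) n = qpoch q (y * q^n) n * (1 - y * q^(2*n))"
        using qpoch_shift[of "y * q^n" q n] unfolding sq by (simp add: mult_ac)
      moreover have "1 - y * q^(2*n) \<noteq> 0"
        using yn by simp
      ultimately show ?thesis
        using yn'(2) by (simp add: frac_eq_eq del: power_Suc)
    qed
    have "(\<Sum>i\<le>n. saal_coeff q X y n i * (\<Sum>j\<le>n. saal_coeff q X y n j * ?mu (i + j)))
       = saal_coeff q X y n n * (\<Sum>j\<le>n. saal_coeff q X y n j * ?mu (n + j))"
    proof -
      have "(\<Sum>i\<le>n. saal_coeff q X y n i * (\<Sum>j\<le>n. saal_coeff q X y n j * ?mu (i + j)))
        = (\<Sum>i\<in>{n}. saal_coeff q X y n i * (\<Sum>j\<le>n. saal_coeff q X y n j * ?mu (i + j)))"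
        by (rule sum.mono_neutral_right) (auto simp: saal_coeff_moment_eq_0[OF q X y] simp del: times_divide_eq_right)
      then show ?thesis by simp
    qed
    also have "\<dots> = (qpoch q (1 / q^n) n * q^n) / qpoch q x n
        * (qpoch q (y * q^n) n / qpoch q (y*q^Suc n) n) * qpoch q (y*q/X) n / qpoch q (y*q) n"
      unfolding saal_coeff_moment[OF q X y] x_def[symmetric] unfolding saal_coeff_def
      using qn Xn q0 by (simp add: mult_ac)
    also have "\<dots> = X^n * qpoch q q n * qpoch q (y*q/X) n / (qpoch q X n * qpoch q (y*q) n)
            * ((1 - y * q^n) / (1 - y * q^(2*n)))"
      unfolding rev top using xn by (simp add: mult_ac)
    finally show ?thesis
      unfolding swap using 3 by simp
  qed
qed

section \<open>Moments of the weight\<close>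

text \<open>\<open>A\<close> stands for \<open>\<mu> b\<^sup>2\<close>; the statement depends on \<open>\<mu>\<close> and \<open>b\<close> only through it.\<close>

locale biorthogonality =
  fixes q A a d e :: complex
  assumes q: "0 < norm q" "norm q < 1"
    and nonzero: "A \<noteq> 0" "a \<noteq> 0" "d \<noteq> 0" "e \<noteq> 0"
    and X_lt: "norm (a*q / (A*e)) < 1"
    and A_ne: "\<And>j. A * q^j \<noteq> 1"
    and aq_ne: "\<And>j. a*q * q^j \<noteq> 1"
    and Ad_ne: "\<And>j. A*d/a * q^j \<noteq> 1"
    and ade_ne: "\<And>j. a*q^2/(d*e) * q^j \<noteq> 1"
    and d_ne: "\<And>j. d * q^j \<noteq> 1"
    and qe_ne: "\<And>j. q/e * q^j \<noteq> 1"
    and Y_ne: "\<And>j. a^2*q^2/(A*d*e) * q^j \<noteq> 1"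
begin

definition "X = a*q / (A*e)"
text \<open>\<open>y q\<close> is the \<open>Y\<close> of the overview, so \<open>y q^n\<close> is
  the third upper parameter of \<open>U\<close> (and \<open>y q^m\<close> that of
  \<open>V\<close>).\<close>

definition "y = a^2*q / (A*d*e)"

text \<open>The constant factor of \<open>weight\<close>; it normalises the total weight to 1, as
  \<open>moment_sums\<close> at \<open>i = j = 0\<close> shows.\<close>

definition mass :: complex where
  "mass = qpoch_inf q (a*q) * qpoch_inf q (A*d/a) * qpoch_inf q X * qpoch_inf q (a*q^2/(d*e))
     / (qpoch_inf q (A*q) * qpoch_inf q d * qpoch_inf q (q/e) * qpoch_inf q (y*q))"

definition wt :: "nat \<Rightarrow> complex" where
  "wt k = (1 - A * q^(2*k)) / (1 - A) * (qpoch q A k * qpoch q (A/a) k * qpoch q (a*q/d) k * qpoch q (A*d*e/(a*q)) k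
     / (qpoch q (a*q) k * qpoch q (A*d/a) k * qpoch q (a*q^2/(d*e)) k * qpoch q q k)) * X^k * mass"

text \<open>The node factors of the \<open>j\<close>-th term of \<open>U\<close> at
  \<open>t = b q^k\<close>. The upper parameter \<open>a q / A\<close> is included so that
  \<open>qpoch_divide_power\<close> applies.\<close>

definition phi :: "nat \<Rightarrow> nat \<Rightarrow> complex" where
  "phi j k = qpoch q (a*q/A) j / (qpoch q (a*q * q^k) j * qpoch q (a*q/A / q^k) j)"

definition psi :: "nat \<Rightarrow> nat \<Rightarrow> complex" where
  "psi i k = qpoch q (a*q^2/(A*d*e)) i / (qpoch q (a*q^2/(d*e) * q^k) i * qpoch q (a*q^2/(A*d*e) / q^k) i)"

lemma q0: "q \<noteq> 0"
  using q by auto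

lemma yq: "y * q = a^2*q^2/(A*d*e)"
  by (simp add: y_def power2_eq_square)

lemma X_power: "norm (X * q^j) < 1"
proof -
  have "norm X * norm q ^ j \<le> norm X * 1"
    using q by (intro mult_left_mono power_le_one) auto
  moreover have "norm X < 1"
    using X_lt by (simp add: X_def)
  ultimately show ?thesis
    by (simp add: norm_mult norm_power)
qed

lemma X_ne: "X * q^j \<noteq> 1"
  using X_power[of j] by auto

lemma X0: "X \<noteq> 0"
  using q0 nonzero by (simp add: X_def)

text \<open>Multiplication by \<open>phi j k\<close> thus replaces \<open>A/a\<close> by
  \<open>A/(a q^j)\<close> and \<open>a q\<close> by \<open>a q^(j+1)\<close> in the weight; the
  left-over \<open>q^(j*k)\<close> goes into the argument of the series.\<close>

lemma phi_shift:
  assumes "qpoch q (a*q/A / q^k) j \<noteq> 0"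
  shows "phi j k * (qpoch q (A/a) k / qpoch q (a*q) k)
       = qpoch q (A / (a * q^j)) k * q^(j*k) / (qpoch q (a*q) j * qpoch q (a*q*q^j) k)"
proof -
  have args: "q / (a*q/A) = A/a" "q / (a*q/A * q^j) = A / (a * q^j)"
    using q0 nonzero by simp_all
  have num: "qpoch q (a*q/A) j * qpoch q (A/a) k = qpoch q (a*q/A / q^k) j * qpoch q (A / (a * q^j)) k * q^(j*k)"
    using qpoch_divide_power[of q "a*q/A" j k, unfolded args] q0 nonzero by simp
  have den: "qpoch q (a*q) k * qpoch q (a*q * q^k) j = qpoch q (a*q) j * qpoch q (a*q*q^j) k"
    by (simp only: qpoch_add[symmetric] add.commute)
  have "phi j k * (qpoch q (A/a) k / qpoch q (a*q) k)
      = (qpoch q (a*q/A) j * qpoch q (A/a) k) / ((qpoch q (a*q) k * qpoch q (a*q * q^k) j) * qpoch q (a*q/A / q^k) j)"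
    by (simp add: phi_def mult_ac)
  then show ?thesis
    unfolding num den using assms by simp
qed

lemma psi_shift:
  assumes "qpoch q (a*q^2/(A*d*e) / q^k) i \<noteq> 0"
  shows "psi i k * (qpoch q (A*d*e/(a*q)) k / qpoch q (a*q^2/(d*e)) k)
       = qpoch q (A*d*e / (a*q * q^i)) k * q^(i*k) / (qpoch q (a*q^2/(d*e)) i * qpoch q (a*q^2/(d*e)*q^i) k)"
proof -
  have args: "q / (a*q^2/(A*d*e)) = A*d*e/(a*q)" "q / (a*q^2/(A*d*e) * q^i) = A*d*e / (a*q * q^i)"
    using q0 nonzero by (simp_all add: power2_eq_square mult_ac)
  have num: "qpoch q (a*q^2/(A*d*e)) i * qpoch q (A*d*e/(a*q)) k
      = qpoch q (a*q^2/(A*d*e) / q^k) i * qpoch q (A*d*e / (a*q * q^i)) k * q^(i*k)"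
    using qpoch_divide_power[of q "a*q^2/(A*d*e)" i k, unfolded args] q0 nonzero by simp
  have den: "qpoch q (a*q^2/(d*e)) k * qpoch q (a*q^2/(d*e) * q^k) i
      = qpoch q (a*q^2/(d*e)) i * qpoch q (a*q^2/(d*e)*q^i) k"
    by (simp only: qpoch_add[symmetric] add.commute)
  have "psi i k * (qpoch q (A*d*e/(a*q)) k / qpoch q (a*q^2/(d*e)) k)
      = (qpoch q (a*q^2/(A*d*e)) i * qpoch q (A*d*e/(a*q)) k)
        / ((qpoch q (a*q^2/(d*e)) k * qpoch q (a*q^2/(d*e) * q^k) i) * qpoch q (a*q^2/(A*d*e) / q^k) i)"
    by (simp add: psi_def mult_ac)
  then show ?thesis
    unfolding num den using assms by simp
qed

lemma moment_sums:
  assumes phi_ne: "\<And>k. qpoch q (a*q/A / q^k) j \<noteq> 0"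
    and psi_ne: "\<And>k. qpoch q (a*q^2/(A*d*e) / q^k) i \<noteq> 0"
  shows "(\<lambda>k. phi j k * psi i k * wt k) sums
     (qpoch q X (i + j) / (qpoch q d j * qpoch q (q/e) i * qpoch q (y*q) (i + j)))"
proof -
  \<comment> \<open>The parameters of the weight after both shifts. The argument collects the
    left-over powers, which keeps \<open>b c f z = A q\<close>.\<close>
  define b c f z where "b = A / (a * q^j)" and "c = a*q/d" and "f = A*d*e / (a*q * q^i)" and "z = X * q^(i + j)"
  have args: "c*f*z = a*q * q^j" "b*f*z = A*d/a" "b*c*z = a*q^2/(d*e) * q^i"
      "b*z = q/e * q^i" "c*z = y*q * q^(i+j)" "f*z = d * q^j" "b*c*f*z = A*q"
    using q0 nonzero by (simp_all add: b_def c_def f_def z_def X_def y_def power_add power2_eq_square mult_ac)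
  interpret vwp q A b c f z
  proof
    show "A * q = b * c * f * z" using args by simp
    show "norm z < 1" unfolding z_def by (rule X_power)
    show "c*f*z * q^l \<noteq> 1" for l
      unfolding args using aq_ne[of "j + l"] by (simp add: power_add mult_ac)
    show "b*c*z * q^l \<noteq> 1" for l
      unfolding args using ade_ne[of "i + l"] by (simp add: power_add mult_ac)
    show "b*f*z * q^l \<noteq> 1" for l
      unfolding args by (rule Ad_ne)
  qed (rule q A_ne)+
  define K where "K = mass / (qpoch q (a*q) j * qpoch q (a*q^2/(d*e)) i)"
  \<comment> \<open>Splitting off these finite parts leaves in \<open>mass\<close> exactly the
    infinite products that cancel against the evaluated series.\<close>
  have inf: "qpoch_inf q (a*q) = qpoch q (a*q) j * qpoch_inf q (a*q*q^j)"
    "qpoch_inf q (a*q^2/(d*e)) = qpoch q (a*q^2/(d*e)) i * qpoch_inf q (a*q^2/(d*e)*q^i)"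
    "qpoch_inf q X = qpoch q X (i+j) * qpoch_inf q (X*q^(i+j))"
    "qpoch_inf q d = qpoch q d j * qpoch_inf q (d*q^j)"
    "qpoch_inf q (q/e) = qpoch q (q/e) i * qpoch_inf q (q/e*q^i)"
    "qpoch_inf q (y*q) = qpoch q (y*q) (i+j) * qpoch_inf q (y*q*q^(i+j))"
    by (rule qpoch_inf_split[OF q(2)])+
  have Aq_ne: "A * q * q^l \<noteq> 1" for l
    using A_ne[of "Suc l"] by (simp add: mult_ac)
  have "qpoch_inf q (a*q) \<noteq> 0" "qpoch_inf q (a*q^2/(d*e)) \<noteq> 0" "qpoch_inf q X \<noteq> 0" "qpoch_inf q d \<noteq> 0"
    "qpoch_inf q (q/e) \<noteq> 0" "qpoch_inf q (y*q) \<noteq> 0" "qpoch_inf q (A*d/a) \<noteq> 0" "qpoch_inf q (A*q) \<noteq> 0"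
    unfolding yq by (intro qpoch_inf_nonzero q aq_ne ade_ne X_ne d_ne qe_ne Y_ne Ad_ne Aq_ne)+
  note nz = this this(1-6)[unfolded inf mult_eq_0_iff de_Morgan_disj]
  have shifted: "phi j k * psi i k * wt k = K * vwp_term q A b c f z k" for k
  proof -
    have zk: "z^k = X^k * q^(j*k) * q^(i*k)"
      by (simp add: z_def power_mult_distrib power_add mult_ac flip: power_mult)
    have "phi j k * psi i k * wt k =
       (phi j k * (qpoch q (A/a) k / qpoch q (a*q) k)) * (psi i k * (qpoch q (A*d*e/(a*q)) k / qpoch q (a*q^2/(d*e)) k))
       * ((1 - A * q^(2*k)) / (1 - A) * (qpoch q A k * qpoch q (a*q/d) k / (qpoch q (A*d/a) k * qpoch q q k)) * X^k * mass)"
      by (simp add: wt_def mult_ac)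
    also have "\<dots> = K * vwp_term q A b c f z k"
      unfolding phi_shift[OF phi_ne] psi_shift[OF psi_ne] vwp_term_def vwp_coeff_def args K_def zk
        b_def[symmetric] c_def[symmetric] f_def[symmetric]
      by (simp add: mult_ac)
    finally show ?thesis .
  qed
  have "(\<lambda>k. K * vwp_term q A b c f z k) sums
     (K * (qpoch_inf q (A*q) * qpoch_inf q (q/e*q^i) * qpoch_inf q (y*q*q^(i+j)) * qpoch_inf q (d*q^j)
      / (qpoch_inf q (a*q*q^j) * qpoch_inf q (A*d/a) * qpoch_inf q (a*q^2/(d*e)*q^i) * qpoch_inf q z)))"
    using sums_mult[OF vwp_sums[OF vwp_axioms, unfolded args]] .
  also have "K * (qpoch_inf q (A*q) * qpoch_inf q (q/e*q^i) * qpoch_inf q (y*q*q^(i+j)) * qpoch_inf q (d*q^j)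
      / (qpoch_inf q (a*q*q^j) * qpoch_inf q (A*d/a) * qpoch_inf q (a*q^2/(d*e)*q^i) * qpoch_inf q z))
    = qpoch q X (i + j) / (qpoch q d j * qpoch q (q/e) i * qpoch q (y*q) (i + j))"
    unfolding K_def mass_def inf z_def using nz by simp
  finally show ?thesis
    unfolding shifted .
qed

section \<open>Biorthogonality up to prefactors\<close>

definition U_sum :: "nat \<Rightarrow> nat \<Rightarrow> complex" where
  "U_sum n k = (\<Sum>j\<le>n. saal_coeff q X y n j * qpoch q d j * phi j k)"

definition V_sum :: "nat \<Rightarrow> nat \<Rightarrow> complex" where
  "V_sum m k = (\<Sum>i\<le>m. saal_coeff q X y m i * qpoch q (q/e) i * psi i k)"

text \<open>The factors \<open>(d)_j\<close> and \<open>(q/e)_i\<close> cancel those in the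
  denominator of the moments, leaving the double sum of
  \<open>saal_coeff_orthogonal\<close>.\<close>

lemma U_V_sums:
  assumes phi_ne: "\<And>k. qpoch q (a*q/A / q^k) n \<noteq> 0"
    and psi_ne: "\<And>k. qpoch q (a*q^2/(A*d*e) / q^k) m \<noteq> 0"
    and yn: "y * q^(2*n) \<noteq> 1"
  shows "(\<lambda>k. U_sum n k * V_sum m k * wt k) sums
     (if n = m then X^n * qpoch q q n * qpoch q (a*q/d) n / (qpoch q X n * qpoch q (y*q) n)
            * ((1 - y * q^n) / (1 - y * q^(2*n))) else 0)"
proof -
  have yX: "y*q/X = a*q/d"
    using q0 nonzero by (simp add: y_def X_def power2_eq_square)
  have dj: "qpoch q d j \<noteq> 0" and ei: "qpoch q (q/e) j \<noteq> 0" for j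
    using d_ne qe_ne by (simp_all add: qpoch_nonzero_iff)
  have "U_sum n k * V_sum m k * wt k = (\<Sum>j\<le>n. \<Sum>i\<le>m. saal_coeff q X y n j * qpoch q d j
      * (saal_coeff q X y m i * qpoch q (q/e) i) * (phi j k * psi i k * wt k))" for k
    unfolding U_sum_def V_sum_def sum_product unfolding sum_distrib_right
    by (intro sum.cong refl) (simp only: mult_ac)
  moreover have "(\<lambda>k. \<Sum>j\<le>n. \<Sum>i\<le>m. saal_coeff q X y n j * qpoch q d j
      * (saal_coeff q X y m i * qpoch q (q/e) i) * (phi j k * psi i k * wt k)) sums
     (\<Sum>j\<le>n. \<Sum>i\<le>m. saal_coeff q X y n j * qpoch q d j * (saal_coeff q X y m i * qpoch q (q/e) i)
       * (qpoch q X (i + j) / (qpoch q d j * qpoch q (q/e) i * qpoch q (y*q) (i + j))))"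
    using qpoch_nonzero_mono[OF phi_ne] qpoch_nonzero_mono[OF psi_ne]
    by (intro sums_sum sums_mult moment_sums) auto
  moreover have "(\<Sum>j\<le>n. \<Sum>i\<le>m. saal_coeff q X y n j * qpoch q d j * (saal_coeff q X y m i * qpoch q (q/e) i)
       * (qpoch q X (i + j) / (qpoch q d j * qpoch q (q/e) i * qpoch q (y*q) (i + j))))
     = (\<Sum>j\<le>n. \<Sum>i\<le>m. saal_coeff q X y n j * saal_coeff q X y m i * (qpoch q X (i + j) / qpoch q (y*q) (i + j)))"
    using dj ei by (intro sum.cong refl) simp
  moreover have y_ne: "y * q * q^j \<noteq> 1" for j
    unfolding yq by (rule Y_ne)
  ultimately show ?thesis
    using saal_coeff_orthogonal[OF q X0 X_ne y_ne yn, of m, unfolded yX] by simp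
qed

end

section \<open>Return to the original parameters\<close>

theorem corollary4p4:
  fixes q a b d e \<mu> :: complex and n m :: nat
  assumes "0 < norm q" and "norm q < 1"
    and "a \<noteq> 0" and "b \<noteq> 0" and "d \<noteq> 0" and "e \<noteq> 0" and "\<mu> \<noteq> 0"
    and "norm (a*q / (\<mu>*b^2*e)) < 1"
    and "\<And>k. U_denoms_nonzero q a b d e \<mu> n (b * q^k)"
    and "\<And>k. V_denoms_nonzero q a b d e \<mu> m (b * q^k)"
    and "\<And>k. weight_denoms_nonzero q a b d e \<mu> k"
    and "norm_const_denoms_nonzero q a b d e \<mu> n"
  shows "(\<lambda>k. U q a b d e \<mu> n (x_node q b \<mu> k) * V q a b d e \<mu> m (x_node q b \<mu> k)
              * weight q a b d e \<mu> k)
         sums (if n = m then norm_const q a b d e \<mu> n else 0)"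
proof -
  define A where "A = \<mu> * b^2"
  have A0: "A \<noteq> 0" using assms by (simp add: A_def)
  have q0: "q \<noteq> 0" using assms by auto
  define s where "s = csqrt A"
  have s2: "s * s = A" by (simp add: s_def flip: power2_eq_square)
  have weight_ne: "qpoch q s k \<noteq> 0" "qpoch q (-s) k \<noteq> 0" "qpoch q (a*q) k \<noteq> 0" "qpoch q (A*d/a) k \<noteq> 0"
      "qpoch q (a*q^2/(d*e)) k \<noteq> 0" for k
    using assms(11)[of k] by (auto simp: weight_denoms_nonzero_def qpochs_def A_def s_def)
  have inf_ne: "qpoch_inf q (A*q) \<noteq> 0" "qpoch_inf q d \<noteq> 0" "qpoch_inf q (q/e) \<noteq> 0"
      "qpoch_inf q (a^2*q^2/(A*d*e)) \<noteq> 0"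
    using assms(11)[of 0] by (auto simp: weight_denoms_nonzero_def qpochs_inf_def A_def)
  have ne_one: "x * q^j \<noteq> 1" if "\<And>k. qpoch q x k \<noteq> 0" for x j
    using that[of "Suc j"] by (auto simp: qpoch_nonzero_iff)
  have inf_ne_one: "x * q^j \<noteq> 1" if "qpoch_inf q x \<noteq> 0" for x j
    by (rule ne_one) (rule qpoch_nonzero_of_inf_nonzero[OF assms(2) that])
  have s_ne: "1 - s \<noteq> 0" "1 + s \<noteq> 0"
    using weight_ne(1,2)[of 1] by (simp_all add: qpoch_Suc)
  have one_minus_A: "1 - A = (1 - s) * (1 + s)"
    by (simp add: s2[symmetric] algebra_simps)
  \<comment> \<open>The case \<open>j = 0\<close> comes from the square-root factors of the weight,
    the others from its infinite product at \<open>A q\<close>.\<close>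
  have A_ne: "A * q^j \<noteq> 1" for j
  proof (cases j)
    case 0
    then show ?thesis using s_ne one_minus_A by auto
  next
    case (Suc i)
    then show ?thesis using inf_ne_one[OF inf_ne(1), of i] by (simp add: mult_ac)
  qed
  interpret biorthogonality q A a d e
    by unfold_locales
       (use assms A0 A_ne ne_one[OF weight_ne(3)] ne_one[OF weight_ne(4)] ne_one[OF weight_ne(5)]
          inf_ne_one[OF inf_ne(2)] inf_ne_one[OF inf_ne(3)] inf_ne_one[OF inf_ne(4)] in \<open>auto simp: A_def\<close>)
  have powi: "q powi (- int l) = 1 / q^l" for l
    by (simp add: power_int_minus divide_inverse)

  define cU where "cU = 1 / d^n * (qpoch q (a*q) n * qpoch q X n / (qpoch q (a*q/d) n * qpoch q (a*q/(A*d*e)) n))"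
  define cV where "cV = (e/q)^m * (qpoch q (a*q^2/(d*e)) m * qpoch q X m / (qpoch q (a*q/d) m * qpoch q (a/A) m))"

  have argsU: "a*q/b * (b * q^k) = a*q * q^k" "a*q/(b*\<mu>) * inverse (b * q^k) = a*q/A / q^k" for k
    using assms(4,7) q0 by (simp_all add: A_def field_simps power2_eq_square)
  have argsV: "a*q^2/(b*d*e) * (b * q^k) = a*q^2/(d*e) * q^k"
      "a*q^2/(\<mu>*b*d*e) * inverse (b * q^k) = a*q^2/(A*d*e) / q^k" for k
    using assms(4-7) q0 by (simp_all add: A_def field_simps power2_eq_square)
  have Y: "a^2 * q^(1+l) / (A*d*e) = y * q^l" "a^2 * q^(l+1) / (A*d*e) = y * q^l" for l
    by (simp_all add: y_def)

  have U: "U q a b d e \<mu> n (x_node q b \<mu> k) = cU * U_sum n k" for k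
  proof -
    have "U q a b d e \<mu> n (x_node q b \<mu> k) = U_par q a b d e \<mu> n (b * q^k)"
      unfolding x_node_eq_x_of by (rule U_x_of) (use assms q0 in auto)
    also have "\<dots> = cU * U_sum n k"
      unfolding U_par_def phi43_def argsU A_def[symmetric] Y powi X_def[symmetric]
      by (simp add: U_sum_def saal_coeff_def phi_def cU_def qpochs_def mult_ac)
    finally show ?thesis .
  qed
  have V: "V q a b d e \<mu> m (x_node q b \<mu> k) = cV * V_sum m k" for k
  proof -
    have "V q a b d e \<mu> m (x_node q b \<mu> k) = V_par q a b d e \<mu> m (b * q^k)"
      unfolding x_node_eq_x_of by (rule V_x_of) (use assms q0 in auto)
    also have "\<dots> = cV * V_sum m k"
      unfolding V_par_def phi43_def argsV A_def[symmetric] Y powi X_def[symmetric]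
      by (simp add: V_sum_def saal_coeff_def psi_def cV_def qpochs_def mult_ac)
    finally show ?thesis .
  qed
  have weight: "weight q a b d e \<mu> k = wt k" for k
  proof -
    have shift: "qpoch q (q*x) k = qpoch q x k * (1 - x * q^k) / (1 - x)" if "1 - x \<noteq> 0" for x
      using qpoch_shift[of x q k] that by (simp add: eq_divide_eq mult.commute)
    have neg: "- q * s = q * (-s)" "1 - (-s) \<noteq> 0"
      using s_ne by simp_all
    have cancel: "(u * v / w) * (u' * v' / w') / (u * u') = v * v' / (w * w')" if "u \<noteq> 0" "u' \<noteq> 0"
      for u v w u' v' w' :: complex
      using that by simp
    \<comment> \<open>The factors at \<open>s\<close> and \<open>-s\<close> pair up through
      \<open>s * s = A\<close> into the root-free factor of \<open>wt\<close>.\<close>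
    have "qpoch q (q * s) k * qpoch q (q*(-s)) k / (qpoch q s k * qpoch q (-s) k)
        = (1 - s * q^k) * (1 - (-s) * q^k) / ((1 - s) * (1 - (-s)))"
      unfolding shift[OF s_ne(1)] shift[OF neg(2)] by (rule cancel) (rule weight_ne)+
    also have "(1 - s * q^k) * (1 - (-s) * q^k) = 1 - A * q^(2*k)"
      unfolding mult_2 power_add by (simp add: s2[symmetric] algebra_simps)
    also have "(1 - s) * (1 - (-s)) = 1 - A"
      unfolding one_minus_A by simp
    finally have ratio: "qpoch q (q * s) k * qpoch q (q*(-s)) k / (qpoch q s k * qpoch q (-s) k)
        = (1 - A * q^(2*k)) / (1 - A)" .
    have "weight q a b d e \<mu> k = qpoch q (q * s) k * qpoch q (q*(-s)) k / (qpoch q s k * qpoch q (-s) k)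
       * (qpoch q A k * qpoch q (A/a) k * qpoch q (a*q/d) k * qpoch q (A*d*e/(a*q)) k
       / (qpoch q (a*q) k * qpoch q (A*d/a) k * qpoch q (a*q^2/(d*e)) k * qpoch q q k)) * X^k * mass"
      unfolding weight_def qpochs_def qpochs_inf_def A_def[symmetric] s_def[symmetric] neg
        X_def[symmetric] mass_def yq
      by (simp add: mult_ac)
    then show ?thesis
      unfolding ratio wt_def .
  qed

  have "qpoch q (a*q/(b*\<mu>) * inverse (b * q^k)) n \<noteq> 0" for k
    using assms(9)[of k] by (auto simp: U_denoms_nonzero_def qpochs_def)
  note phi_ne = this[unfolded argsU]
  have "qpoch q (a*q^2/(\<mu>*b*d*e) * inverse (b * q^k)) m \<noteq> 0" for k
    using assms(10)[of k] by (auto simp: V_denoms_nonzero_def qpochs_def)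
  note psi_ne = this[unfolded argsV]
  have adn: "qpoch q (a*q/d) n \<noteq> 0"
    using assms(9)[of 0] by (auto simp: U_denoms_nonzero_def qpochs_def)
  have Xn: "qpoch q X n \<noteq> 0"
    using X_ne by (simp add: qpoch_nonzero_iff)
  have "1 - a^2 * q^(1 + 2*n) / (A*d*e) \<noteq> 0"
    using assms(12) by (simp add: norm_const_denoms_nonzero_def A_def)
  then have yn: "y * q^(2*n) \<noteq> 1"
    unfolding Y by simp
  have "(\<lambda>k. cU * cV * (U_sum n k * V_sum m k * wt k)) sums
     (cU * cV * (if n = m then X^n * qpoch q q n * qpoch q (a*q/d) n / (qpoch q X n * qpoch q (y*q) n)
            * ((1 - y * q^n) / (1 - y * q^(2*n))) else 0))"
    by (intro sums_mult U_V_sums phi_ne psi_ne yn)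
  moreover have "cU * cV * (U_sum n k * V_sum m k * wt k)
      = U q a b d e \<mu> n (x_node q b \<mu> k) * V q a b d e \<mu> m (x_node q b \<mu> k) * weight q a b d e \<mu> k" for k
    unfolding U V weight by (simp only: mult_ac)
  moreover have "cU * cV * (X^n * qpoch q q n * qpoch q (a*q/d) n / (qpoch q X n * qpoch q (y*q) n)
            * ((1 - y * q^n) / (1 - y * q^(2*n)))) = norm_const q a b d e \<mu> n" if "n = m"
  proof -
    \<comment> \<open>The powers in \<open>cU\<close> and \<open>cV\<close> and the
      \<open>X^n\<close> of the orthogonality relation combine to the power in
      \<open>norm_const\<close>.\<close>
    have "1 / d * (e/q) * X = a/(A*d)"
      using q0 assms(6) by (simp add: X_def)
    then have pow: "1 / d^n * (e/q)^n * X^n = (a/(A*d))^n"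
      by (simp flip: power_mult_distrib power_one_over)
    have "cU * cV * (X^n * qpoch q q n * qpoch q (a*q/d) n / (qpoch q X n * qpoch q (y*q) n)
            * ((1 - y * q^n) / (1 - y * q^(2*n))))
       = (1 / d^n * (e/q)^n * X^n) * (qpoch q q n * qpoch q X n * qpoch q (a*q^2/(d*e)) n * qpoch q (a*q) n
          / (qpoch q (a*q/(A*d*e)) n * qpoch q (a*q/d) n * qpoch q (a/A) n * qpoch q (y*q) n))
         * ((1 - y * q^n) / (1 - y * q^(2*n)))"
    proof -
      have cancel: "u1 * (p1 * x / (g * w)) * (u2 * (p2 * x / (g * h)) * (u3 * r * g / (x * v) * t))
         = u1 * u2 * u3 * (r * x * p2 * p1 / (w * g * h * v)) * t"
        if "g \<noteq> 0" "x \<noteq> 0" for u1 u2 u3 p1 p2 x g w h r v t :: complex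
        using that by (simp add: mult_ac)
      show ?thesis
        unfolding cU_def cV_def that[symmetric] mult.assoc[of "_ * (_ / _)"]
        using cancel[OF adn Xn] by (simp only: mult.assoc)
    qed
    then show ?thesis
      unfolding pow norm_const_def qpochs_def A_def[symmetric] Y yq[symmetric] X_def[symmetric]
      by (simp add: mult_ac)
  qed
  ultimately show ?thesis
    by (cases "n = m") simp_all
qed

end
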